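(* If $f\not\equiv0$ is a meromorphic function on $\mathbb{C}$ of finite order $\sigma$, then for every $\varepsilon>0$, $$m\left(r,\frac{\mathcal{D}_{\mathrm{W}}f}{f}\right)=O(r^{\sigma-\frac12+\varepsilon})$$ as $r\to\infty$.
   Context: The Wilson operator $\mathcal{D}_{\mathrm{W}}$: for $x\ne0$ and $z$ with $z^2=x$, $$(\mathcal{D}_{\mathrm{W}}f)(x):=\frac{f((z+\frac i2)^2)-f((z-\frac i2)^2)}{2iz},$$ which does not depend on the choice of $z$; at $x=0$ the value is the limit as $x\to0$, which is $f'(-\frac14)$ if $f$ is differentiable at $-\frac14$. If $f$ is meromorphic on $\mathbb{C}$, so is $\mathcal{D}_{\mathrm{W}}f$. $m(r,g)=\frac1{2\pi}\int_0^{2\pi}\ln^+|g(re^{i\theta})|\,d\theta$ is the Nevanlinna proximity function. The order of $f$ is $\limsup_{r\to\infty}\frac{\ln^+T(r,f)}{\ln r}$, with $T$ the Nevanlinna characteristic. *)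

theory Defs
  imports "HOL-Complex_Analysis.Complex_Analysis" "HOL-Library.Landau_Symbols"
begin

definition wilson_quotient :: "(complex \<Rightarrow> complex) \<Rightarrow> complex \<Rightarrow> complex" where
  "wilson_quotient f z =
     (f ((z + \<i> / 2) ^ 2) - f ((z - \<i> / 2) ^ 2)) / (2 * \<i> * z)"

text \<open>The principal root is used as the choice of \<open>z\<close> with \<open>z\<^sup>2 = x\<close>; by \<open>wilson_op_eq\<close> below
  every other choice gives the same value.\<close>

definition wilson_op :: "(complex \<Rightarrow> complex) \<Rightarrow> complex \<Rightarrow> complex" where
  "wilson_op f x =
     (if x = 0 then Lim (at 0) (\<lambda>y. wilson_quotient f (csqrt y))
      else wilson_quotient f (csqrt x))"

lemma wilson_quotient_minus: "wilson_quotient f (- z) = wilson_quotient f z"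
proof -
  have "(- z + \<i> / 2) ^ 2 = (z - \<i> / 2) ^ 2" "(- z - \<i> / 2) ^ 2 = (z + \<i> / 2) ^ 2"
    by (simp_all add: power2_eq_square algebra_simps)
  thus ?thesis
    unfolding wilson_quotient_def by (simp add: divide_simps)
qed

lemma wilson_op_eq:
  assumes "x \<noteq> 0" "z ^ 2 = x"
  shows "wilson_op f x = wilson_quotient f z"
proof -
  have "(csqrt x) ^ 2 = z ^ 2"
    using assms by simp
  hence "csqrt x = z \<or> csqrt x = - z"
    by (simp only: power2_eq_iff)
  thus ?thesis
    using assms by (auto simp: wilson_op_def wilson_quotient_minus)
qed

lemma wilson_op_0:
  assumes "(f has_field_derivative D) (at (- 1 / 4))"
  shows "wilson_op f 0 = D"
proof -
  define g where "g z = f ((z + \<i> / 2) ^ 2)" for z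
  have sq: "(0 + \<i> / 2) ^ 2 = - 1 / 4"
    by (simp add: power2_eq_square)
  have "((\<lambda>z. (z + \<i> / 2) ^ 2) has_field_derivative \<i>) (at 0)"
    by (auto intro!: derivative_eq_intros)
  from DERIV_chain2[of f D "\<lambda>z. (z + \<i> / 2) ^ 2" 0 \<i> UNIV] assms sq this
  have g: "(g has_field_derivative D * \<i>) (at 0)"
    unfolding g_def by simp
  have g': "((\<lambda>z. g (- z)) has_field_derivative (D * \<i>) * (- 1)) (at 0)"
    by (rule DERIV_chain2[where f = g]) (use g in \<open>auto intro!: derivative_eq_intros\<close>)
  have "((\<lambda>z. g z - g (- z)) has_field_derivative 2 * \<i> * D) (at 0)"
    using DERIV_diff[OF g g'] by (simp add: algebra_simps)
  hence "((\<lambda>z. (g z - g (- z)) / z) \<longlongrightarrow> 2 * \<i> * D) (at 0)"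
    by (simp add: has_field_derivative_iff)
  hence "((\<lambda>z. (g z - g (- z)) / z / (2 * \<i>)) \<longlongrightarrow> 2 * \<i> * D / (2 * \<i>)) (at 0)"
    by (intro tendsto_divide tendsto_const) auto
  moreover have "(g z - g (- z)) / z / (2 * \<i>) = wilson_quotient f z" for z
  proof -
    have "(- z + \<i> / 2) ^ 2 = (z - \<i> / 2) ^ 2"
      by (simp add: power2_eq_square algebra_simps)
    thus ?thesis
      by (simp add: g_def wilson_quotient_def mult_ac)
  qed
  ultimately have q: "(wilson_quotient f \<longlongrightarrow> D) (at 0)"
    by simp
  have "((\<lambda>y::complex. sqrt (norm y)) \<longlongrightarrow> sqrt (norm (0::complex))) (at 0)"
    by (intro tendsto_intros)
  hence "((\<lambda>y. norm (csqrt y)) \<longlongrightarrow> 0) (at 0)"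
    by simp
  hence "(csqrt \<longlongrightarrow> 0) (at 0)"
    by (simp only: tendsto_norm_zero_iff)
  hence "filterlim csqrt (at 0) (at 0)"
    by (auto simp: filterlim_at eventually_at_filter)
  hence "((\<lambda>y. wilson_quotient f (csqrt y)) \<longlongrightarrow> D) (at 0)"
    using q by (rule filterlim_compose[rotated])
  thus ?thesis
    by (simp add: wilson_op_def tendsto_Lim)
qed

definition ln_plus :: "real \<Rightarrow> real" where
  "ln_plus x = ln (max 1 x)"

definition proximity :: "real \<Rightarrow> (complex \<Rightarrow> complex) \<Rightarrow> real" where
  "proximity r g = 1 / (2 * pi) * integral {0..2 * pi} (\<lambda>\<theta>. ln_plus (norm (g (of_real r * cis \<theta>))))"

text \<open>At a pole, \<open>zorder\<close> is minus the multiplicity.\<close>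

definition pole_count :: "real \<Rightarrow> (complex \<Rightarrow> complex) \<Rightarrow> nat" where
  "pole_count t f = (\<Sum>z | norm z \<le> t \<and> is_pole f z. nat (- zorder f z))"

definition pole_counting :: "real \<Rightarrow> (complex \<Rightarrow> complex) \<Rightarrow> real" where
  "pole_counting r f =
     integral {0..r} (\<lambda>t. (real (pole_count t f) - real (pole_count 0 f)) / t)
     + real (pole_count 0 f) * ln r"

definition nevanlinna_char :: "real \<Rightarrow> (complex \<Rightarrow> complex) \<Rightarrow> real" where
  "nevanlinna_char r f = proximity r f + pole_counting r f"

definition mero_order :: "(complex \<Rightarrow> complex) \<Rightarrow> ereal" where
  "mero_order f = Limsup at_top (\<lambda>r. ereal (ln_plus (nevanlinna_char r f) / ln r))"

end

theory Submission
  imports Defs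
begin

text \<open>Write \<open>x = z\<^sup>2\<close> with \<open>norm z = sqrt r\<close>, so that the two arguments \<open>y\<close> of \<open>f\<close> in the Wilson
  operator satisfy \<open>norm (y - x) = O(sqrt r)\<close>. For \<open>r\<close> large the factor \<open>1 / (2 * norm z)\<close> absorbs the
  sum of the two terms, and it suffices to bound the mean over the circle of the absolute value of
  \<open>ln (norm (f y) / norm (f x))\<close>. Choose \<open>R\<close> between \<open>2 * r\<close> and \<open>3 * r\<close> with no zero or pole of \<open>f\<close> on
  the circle of radius \<open>R\<close>, and factor \<open>f\<close> as a product of Blaschke factors times \<open>exp h\<close>. By the
  Schwarz formula the exponential contributes \<open>O(1 / sqrt r)\<close> times the mean of
  \<open>\<bar>ln (norm f)\<bar>\<close> over that circle. A Blaschke factor at \<open>a\<close> contributes, for any fixed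
  \<open>0 < \<alpha> < 1\<close>, at most a constant times \<open>1 / sqrt r\<close> plus
  \<open>r powr (\<alpha> / 2) * (norm (x - a) powr -\<alpha> + norm (y - a) powr -\<alpha>)\<close>, whose circular mean is
  \<open>O(r powr (- \<alpha> / 2))\<close> uniformly in \<open>a\<close>. Jensen's formula bounds both the number of zeros and poles
  and the mean of \<open>\<bar>ln (norm f)\<bar>\<close> by the Nevanlinna characteristic, and \<open>\<alpha>\<close> is taken close to \<open>1\<close>.\<close>

section \<open>Means of negative powers of the distance on a circle\<close>

text \<open>The angles \<open>(s - t) / 2\<close> that occur below may pass pi / 2, up to 3 pi / 4,
  so the constant 2 / pi of Jordan's inequality gives way to 1 / 6. Up to 1 the cubic Taylor bound
  suffices; from 1 to 3 pi / 4 the sine is at least 1 / 2, whereas t / 6 stays below 1 / 2.\<close>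

lemma abs_sin_ge:
  fixes u :: real
  assumes "\<bar>u\<bar> \<le> 3 * pi / 4"
  shows "\<bar>u\<bar> / 6 \<le> \<bar>sin u\<bar>"
proof -
  have jordan: "t / 6 \<le> sin t" if "0 \<le> t" "t \<le> 3 * pi / 4" for t :: real
  proof (cases "t \<le> 1")
    case True
    have "\<bar>sin t - t\<bar> * 6 \<le> t ^ 3"
      using Maclaurin_sin_bound[of t 3] that
      by (simp add: eval_nat_numeral sin_coeff_def)
    hence "sin t \<ge> t - t ^ 3 / 6" using abs_ge_minus_self[of "sin t - t"] by argo
    moreover have "t ^ 3 \<le> t"
      using that True by (simp add: power_le_one_iff power3_eq_cube mult_le_one mult_left_le_one_le)
    ultimately show ?thesis using that by auto
  next
    case False
    have s: "sin t \<ge> 1 / 2"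
    proof (cases "t \<le> pi / 2")
      case True
      have "sin (pi / 6) \<le> sin t"
        using True False pi_less_4 by (intro sin_monotone_2pi_le) auto
      thus ?thesis by (simp add: sin_30)
    next
      case False
      have "sin (pi / 6) \<le> sin (pi - t)"
        using that False by (intro sin_monotone_2pi_le) auto
      thus ?thesis by (simp add: sin_30)
    qed
    show ?thesis using s that pi_less_4 by (auto simp: field_simps)
  qed
  show ?thesis
  proof (cases "u \<ge> 0")
    case True
    thus ?thesis using jordan[of u] assms by auto
  next
    case False
    thus ?thesis using jordan[of "- u"] assms by auto
  qed
qed

lemma norm_cis_diff: "norm (cis s - cis t) = 2 * \<bar>sin ((s - t) / 2)\<bar>"
proof -
  have "(norm (cis s - cis t))\<^sup>2 = (cos s - cos t)\<^sup>2 + (sin s - sin t)\<^sup>2"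
    by (simp add: cmod_power2)
  also have "\<dots> = 2 - 2 * cos (s - t)"
    using sin_cos_squared_add[of s] sin_cos_squared_add[of t]
    by (simp add: cos_diff power2_eq_square algebra_simps)
  also have "\<dots> = (2 * \<bar>sin ((s - t) / 2)\<bar>)\<^sup>2"
  proof -
    have "2 * ((s - t) / 2) = s - t" by simp
    from cos_double_sin[of "(s - t) / 2"] have "cos (s - t) = 1 - 2 * (sin ((s - t) / 2))\<^sup>2"
      by (simp only: \<open>2 * ((s - t) / 2) = s - t\<close>)
    thus ?thesis by (simp add: power_mult_distrib)
  qed
  finally show ?thesis by (rule power2_eq_imp_eq) auto
qed

lemma norm_cis_diff_ge:
  assumes "\<bar>s - t\<bar> \<le> 3 * pi / 2"
  shows "\<bar>s - t\<bar> / 6 \<le> norm (cis s - cis t)"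
  using abs_sin_ge[of "(s - t) / 2"] assms by (simp add: norm_cis_diff)

text \<open>The half angle \<theta> / 2 runs through [0, pi] only. With an argument \<phi> of
  \<gamma> chosen in [-pi / 2, 3 pi / 2], the difference \<theta> / 2 - \<phi> never wraps around
  the circle, so the chord is bounded below linearly. The point is p = 2 \<phi>, and 24 = 6 * 2 * 2
  collects the sine constant, the half angle and the radial projection of \<gamma>.\<close>

lemma norm_half_circle_ge:
  fixes \<gamma> :: complex and s :: real
  assumes "s > 0"
  obtains p where "p \<in> {-pi..3 * pi}"
    "\<And>\<theta>. \<theta> \<in> {0..2 * pi} \<Longrightarrow> s / 24 * \<bar>\<theta> - p\<bar> \<le> norm (of_real s * cis (\<theta> / 2) - \<gamma>)"
proof -
  obtain \<phi> where \<phi>: "\<phi> \<in> {-pi/2..3*pi/2}" "\<gamma> = of_real (norm \<gamma>) * cis \<phi>"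
  proof (cases "Arg \<gamma> \<ge> - pi / 2")
    case True
    thus ?thesis using that[of "Arg \<gamma>"] Arg_bounded[of \<gamma>] rcis_cmod_Arg[of \<gamma>]
      by (auto simp: rcis_def)
  next
    case False
    have "cis (Arg \<gamma> + 2 * pi) = cis (Arg \<gamma>)" by (simp add: complex_eq_iff)
    thus ?thesis using that[of "Arg \<gamma> + 2 * pi"] False Arg_bounded[of \<gamma>] rcis_cmod_Arg[of \<gamma>]
      by (auto simp: rcis_def)
  qed
  show ?thesis
  proof
    show "2 * \<phi> \<in> {-pi..3 * pi}" using \<phi> by auto
    fix \<theta> assume \<theta>: "\<theta> \<in> {0..2 * pi}"
    define u v where "u = cis (\<theta> / 2)" and "v = cis \<phi>"
    \<comment> \<open>The point \<open>of_real s * v\<close> is the projection of \<gamma> to the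
      circle. Its distance to \<gamma> is the difference of the moduli, hence at most the distance
      from \<gamma> to \<open>of_real s * u\<close>; this costs a factor 2.\<close>
    have "norm (of_real s * u - of_real s * v)
        \<le> norm (of_real s * u - \<gamma>) + norm (of_real (norm \<gamma>) * v - of_real s * v)"
      using \<phi>(2) norm_triangle_ineq[of "of_real s * u - \<gamma>" "\<gamma> - of_real s * v"]
      by (simp add: v_def)
    also have "of_real (norm \<gamma>) * v - of_real s * v = of_real (norm \<gamma> - s) * v"
      by (simp add: algebra_simps)
    also have "norm \<dots> = \<bar>norm \<gamma> - norm (of_real s * u)\<bar>"
      using assms by (simp add: norm_mult u_def v_def del: of_real_diff)
    also have "\<dots> \<le> norm (of_real s * u - \<gamma>)"
      by (metis norm_triangle_ineq3 norm_minus_commute)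
    finally have "norm (of_real s * u - of_real s * v) \<le> 2 * norm (of_real s * u - \<gamma>)" by simp
    moreover have "of_real s * u - of_real s * v = of_real s * (u - v)" by (simp add: algebra_simps)
    ultimately have 1: "s * norm (u - v) \<le> 2 * norm (of_real s * u - \<gamma>)"
      using assms by (simp add: norm_mult)
    have "0 \<le> \<theta>" "\<theta> \<le> 2 * pi" "- pi / 2 \<le> \<phi>" "\<phi> \<le> 3 * pi / 2"
      using \<theta> \<phi>(1) by auto
    hence "\<bar>\<theta> / 2 - \<phi>\<bar> \<le> 3 * pi / 2" by linarith
    hence "\<bar>\<theta> / 2 - \<phi>\<bar> / 6 \<le> norm (u - v)"
      unfolding u_def v_def by (rule norm_cis_diff_ge)
    hence "s * (\<bar>\<theta> / 2 - \<phi>\<bar> / 6) \<le> s * norm (u - v)" using assms by simp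
    with 1 have "s * (\<bar>\<theta> / 2 - \<phi>\<bar> / 6) \<le> 2 * norm (of_real s * u - \<gamma>)" by linarith
    moreover have "\<bar>\<theta> / 2 - \<phi>\<bar> = \<bar>\<theta> - 2 * \<phi>\<bar> / 2" by (simp add: abs_if field_simps)
    ultimately show "s / 24 * \<bar>\<theta> - 2 * \<phi>\<bar> \<le> norm (of_real s * cis (\<theta> / 2) - \<gamma>)"
      by (simp add: u_def)
  qed
qed

lemma has_integral_abs_powr:
  fixes p L \<alpha> :: real
  assumes "\<alpha> < 1" "L \<ge> 0"
  shows "((\<lambda>x. \<bar>x - p\<bar> powr -\<alpha>) has_integral 2 * L powr (1 - \<alpha>) / (1 - \<alpha>)) {p - L..p + L}"
proof -
  have 0: "((\<lambda>x. x powr -\<alpha>) has_integral L powr (1 - \<alpha>) / (1 - \<alpha>)) {0..L}"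
    using has_integral_powr_from_0[of "-\<alpha>" L] assms by simp
  have "((\<lambda>x. (x + (- p)) powr -\<alpha>) has_integral L powr (1 - \<alpha>) / (1 - \<alpha>)) {p..p + L}"
    using has_integral_affinity[OF 0[folded cbox_interval], of 1 "-p"] by (simp add: image_affinity_atLeastAtMost add.commute)
  hence 1: "((\<lambda>x. \<bar>x - p\<bar> powr -\<alpha>) has_integral L powr (1 - \<alpha>) / (1 - \<alpha>)) {p..p + L}"
    by (rule has_integral_eq[of "{p..p + L}" "\<lambda>x. (x + - p) powr -\<alpha>", rotated]) (auto simp: add.commute)
  have "((\<lambda>x. (- x + p) powr -\<alpha>) has_integral L powr (1 - \<alpha>) / (1 - \<alpha>)) {p - L..p}"
    using has_integral_affinity[OF 0[folded cbox_interval], of "-1" p] by (simp add: image_affinity_atLeastAtMost)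
  hence 2: "((\<lambda>x. \<bar>x - p\<bar> powr -\<alpha>) has_integral L powr (1 - \<alpha>) / (1 - \<alpha>)) {p - L..p}"
    by (rule has_integral_eq[of "{p - L..p}" "\<lambda>x. (- x + p) powr -\<alpha>", rotated]) auto
  show ?thesis
    using has_integral_combine[OF _ _ 2 1] assms by simp
qed

text \<open>The linear lower bound reduces the integral to that of a power of \<bar>\<theta> -
  p\<bar>, which is finite because \<alpha> < 1. The interval of radius 3 pi about p contains
  [0, 2 pi] wherever p lies, so the constant does not depend on \<gamma>.\<close>

lemma integral_half_circle_powr:
  fixes \<gamma> :: complex and s \<alpha> :: real
  assumes "0 < \<alpha>" "\<alpha> < 1" "s > 0"
  defines "C \<equiv> 24 powr \<alpha> * (2 * (3 * pi) powr (1 - \<alpha>) / (1 - \<alpha>))"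
  shows "(\<lambda>\<theta>. norm (of_real s * cis (\<theta> / 2) - \<gamma>) powr -\<alpha>) integrable_on {0..2 * pi}" (is "?u integrable_on _")
    and "integral {0..2 * pi} (\<lambda>\<theta>. norm (of_real s * cis (\<theta> / 2) - \<gamma>) powr -\<alpha>) \<le> C * s powr -\<alpha>"
proof -
  obtain p where p: "p \<in> {-pi..3 * pi}"
    "\<And>\<theta>. \<theta> \<in> {0..2 * pi} \<Longrightarrow> s / 24 * \<bar>\<theta> - p\<bar> \<le> norm (of_real s * cis (\<theta> / 2) - \<gamma>)"
    using norm_half_circle_ge[OF assms(3)] by blast
  define w where "w = (\<lambda>\<theta>. (s / 24) powr -\<alpha> * \<bar>\<theta> - p\<bar> powr -\<alpha>)"
  \<comment> \<open>At \<theta> = p the majorant \<open>w\<close> is 0, since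
    \<open>0 powr -\<alpha> = 0\<close>, although the integrand may be positive there. Changing this
    single value makes the domination hold everywhere.\<close>
  define w' where "w' = (\<lambda>\<theta>. if \<theta> = p then ?u p else w \<theta>)"
  have wI: "(w has_integral (s / 24) powr -\<alpha> * (2 * (3 * pi) powr (1 - \<alpha>) / (1 - \<alpha>))) {p - 3 * pi..p + 3 * pi}"
    unfolding w_def using assms by (intro has_integral_mult_right has_integral_abs_powr) auto
  have eq: "(s / 24) powr -\<alpha> * (2 * (3 * pi) powr (1 - \<alpha>) / (1 - \<alpha>)) = C * s powr -\<alpha>"
    using assms by (simp add: powr_divide C_def powr_minus field_simps)
  have sub: "{0..2 * pi} \<subseteq> {p - 3 * pi..p + 3 * pi}" using p by auto
  have wi: "w integrable_on {0..2 * pi}"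
    using integrable_subinterval_real[OF _ sub] wI by blast
  have wle: "integral {0..2 * pi} w \<le> C * s powr -\<alpha>"
  proof -
    have "integral {0..2 * pi} w \<le> integral {p - 3 * pi..p + 3 * pi} w"
      using wi wI sub by (intro integral_subset_le) (auto simp: w_def)
    thus ?thesis using wI eq by (simp add: integral_unique)
  qed
  have w'i: "w' integrable_on {0..2 * pi}"
    by (rule integrable_spike_finite[OF _ _ wi, of "{p}"]) (auto simp: w'_def)
  have w'e: "integral {0..2 * pi} w' = integral {0..2 * pi} w"
    by (rule integral_spike[of "{p}"]) (auto simp: w'_def)
  have le: "?u \<theta> \<le> w' \<theta>" if "\<theta> \<in> {0..2 * pi}" for \<theta>
  proof (cases "\<theta> = p")
    case False
    have "?u \<theta> \<le> (s / 24 * \<bar>\<theta> - p\<bar>) powr -\<alpha>"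
      using p(2)[OF that] False assms by (intro powr_mono2') auto
    also have "\<dots> = w' \<theta>" using False assms(3) by (simp only: w'_def w_def powr_mult if_False)
    finally show ?thesis .
  qed (auto simp: w'_def)
  show ui: "?u integrable_on {0..2 * pi}"
  proof (rule measurable_bounded_by_integrable_imp_integrable_real[OF _ w'i])
    have "?u \<in> borel_measurable borel"
      unfolding cis_conv_exp by measurable
    thus "?u \<in> borel_measurable (lebesgue_on {0..2 * pi})"
      by (intro measurable_restrict_space1 measurable_completion) simp
  qed (use le in auto)
  show "integral {0..2 * pi} ?u \<le> C * s powr -\<alpha>"
    using integral_le[OF ui w'i le] w'e wle by linarith
qed

text \<open>With \<beta> a square root of a and z the shifted point, the difference factors as (z -
  \<beta>)(z + \<beta>). The factors add up to 2 z and \<bar>z\<bar> \<ge> s / 2, so one of them has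
  modulus at least s / 2; the other is integrated by the half-circle estimate. Each factor gives s
  to the power -\<alpha>, uniformly in a and \<delta>. The majorant \<open>w\<close> contains both
  choices, so no splitting of the interval is required.\<close>

lemma integral_shifted_square_powr:
  fixes \<delta> a :: complex and s \<alpha> :: real
  assumes "0 < \<alpha>" "\<alpha> < 1" "s \<ge> 1" "norm \<delta> \<le> 1 / 2"
  defines "C \<equiv> 2 * 2 powr \<alpha> * (24 powr \<alpha> * (2 * (3 * pi) powr (1 - \<alpha>) / (1 - \<alpha>)))"
  shows "(\<lambda>\<theta>. norm ((of_real s * cis (\<theta> / 2) + \<delta>)\<^sup>2 - a) powr -\<alpha>) integrable_on {0..2 * pi}" (is "?v integrable_on _")
    and "integral {0..2 * pi} (\<lambda>\<theta>. norm ((of_real s * cis (\<theta> / 2) + \<delta>)\<^sup>2 - a) powr -\<alpha>) \<le> C * s powr (-2 * \<alpha>)"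
proof -
  define \<beta> where "\<beta> = csqrt a"
  define u where "u \<gamma> \<theta> = norm (of_real s * cis (\<theta> / 2) - \<gamma>) powr -\<alpha>" for \<gamma> \<theta>
  define w where "w = (\<lambda>\<theta>. (s / 2) powr -\<alpha> * (u (\<beta> - \<delta>) \<theta> + u (- \<beta> - \<delta>) \<theta>))"
  note ui = integral_half_circle_powr[OF assms(1,2), of s, folded u_def]
  have wi: "w integrable_on {0..2 * pi}"
    unfolding w_def using ui(1) assms by (intro integrable_on_mult_right integrable_add) auto
  have le: "?v \<theta> \<le> w \<theta>" for \<theta>
  proof -
    define z where "z = of_real s * cis (\<theta> / 2) + \<delta>"
    have zs: "norm z \<ge> s / 2"
      using norm_triangle_ineq2[of "of_real s * cis (\<theta> / 2)" "- \<delta>"] assms by (simp add: z_def norm_mult)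
    have fac: "z\<^sup>2 - a = (z - \<beta>) * (z + \<beta>)"
      by (simp add: \<beta>_def algebra_simps flip: power2_eq_square)
    have w: "w \<theta> = (s / 2) powr -\<alpha> * (norm (z - \<beta>) powr -\<alpha> + norm (z + \<beta>) powr -\<alpha>)"
      by (simp add: w_def u_def z_def algebra_simps)
    have half: "norm (P * Q) powr -\<alpha> \<le> (s / 2) powr -\<alpha> * norm P powr -\<alpha>" if "norm Q \<ge> s / 2" for P Q :: complex
    proof -
      have "norm Q powr -\<alpha> \<le> (s / 2) powr -\<alpha>"
        using that assms by (intro powr_mono2') auto
      hence "norm P powr -\<alpha> * norm Q powr -\<alpha> \<le> norm P powr -\<alpha> * (s / 2) powr -\<alpha>"
        by (intro mult_left_mono) auto
      thus ?thesis by (simp add: norm_mult powr_mult mult.commute)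
    qed
    have "2 * norm z \<le> norm (z - \<beta>) + norm (z + \<beta>)"
      using norm_triangle_ineq[of "z - \<beta>" "z + \<beta>"] by (simp flip: mult_2 add: norm_mult)
    hence "norm (z - \<beta>) \<ge> s / 2 \<or> norm (z + \<beta>) \<ge> s / 2"
      using zs by linarith
    hence "norm (z\<^sup>2 - a) powr -\<alpha> \<le> w \<theta>"
    proof
      assume "norm (z - \<beta>) \<ge> s / 2"
      from half[OF this, of "z + \<beta>"] have "norm (z\<^sup>2 - a) powr -\<alpha> \<le> (s / 2) powr -\<alpha> * norm (z + \<beta>) powr -\<alpha>"
        by (simp add: fac mult.commute)
      also have "\<dots> \<le> w \<theta>" unfolding w by (intro mult_left_mono) auto
      finally show ?thesis .
    next
      assume "norm (z + \<beta>) \<ge> s / 2"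
      from half[OF this, of "z - \<beta>"] have "norm (z\<^sup>2 - a) powr -\<alpha> \<le> (s / 2) powr -\<alpha> * norm (z - \<beta>) powr -\<alpha>"
        by (simp add: fac)
      also have "\<dots> \<le> w \<theta>" unfolding w by (intro mult_left_mono) auto
      finally show ?thesis .
    qed
    thus ?thesis by (simp add: z_def)
  qed
  show vi: "?v integrable_on {0..2 * pi}"
  proof (rule measurable_bounded_by_integrable_imp_integrable_real[OF _ wi])
    have "?v \<in> borel_measurable borel"
      unfolding cis_conv_exp by measurable
    thus "?v \<in> borel_measurable (lebesgue_on {0..2 * pi})"
      by (intro measurable_restrict_space1 measurable_completion) simp
  qed (use le in auto)
  define K where "K = 24 powr \<alpha> * (2 * (3 * pi) powr (1 - \<alpha>) / (1 - \<alpha>))"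
  have "integral {0..2 * pi} ?v \<le> integral {0..2 * pi} w"
    using integral_le[OF vi wi le] by simp
  also have "\<dots> = (s / 2) powr -\<alpha> * (integral {0..2 * pi} (u (\<beta> - \<delta>)) + integral {0..2 * pi} (u (- \<beta> - \<delta>)))"
    unfolding w_def using ui(1) assms by (simp add: integral_add)
  also have "\<dots> \<le> (s / 2) powr -\<alpha> * (K * s powr -\<alpha> + K * s powr -\<alpha>)"
    using assms(3) ui(2)[of "\<beta> - \<delta>", folded K_def] ui(2)[of "-\<beta> - \<delta>", folded K_def]
    by (intro mult_left_mono add_mono) auto
  also have "\<dots> = C * (s powr -\<alpha> * s powr -\<alpha>)"
  proof -
    have "(s / 2) powr -\<alpha> = 2 powr \<alpha> * s powr -\<alpha>"
      using assms by (simp add: powr_divide powr_minus field_simps)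
    moreover have "C = 2 * 2 powr \<alpha> * K" by (simp only: C_def K_def)
    ultimately show ?thesis by simp
  qed
  also have "s powr -\<alpha> * s powr -\<alpha> = s powr (-2 * \<alpha>)"
    by (simp flip: powr_add)
  finally show "integral {0..2 * pi} ?v \<le> C * s powr (-2 * \<alpha>)" .
qed

section \<open>The Schwarz integral formula\<close>

text \<open>On the circle du = i u dt; stating the value as \<open>\<i> * I\<close> lets the factor
  i cancel.\<close>

lemma circlepath_integral_has_integral:
  assumes "(f has_contour_integral \<i> * I) (circlepath 0 R)"
  shows "((\<lambda>t. f (of_real R * cis t) * (of_real R * cis t)) has_integral I) {0..2 * pi}"
proof -
  have "((\<lambda>t. f (of_real R * cis t) * of_real R * \<i> * cis t) has_integral \<i> * I) {0..2 * pi}"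
    using assms has_contour_integral_part_circlepath_iff[of 0 "2 * pi" f "\<i> * I" 0 R]
    by (simp add: circlepath_def)
  from has_integral_mult_right[OF this, of "1 / \<i>"] show ?thesis
    by (simp add: mult_ac)
qed

lemma continuous_on_circle:
  assumes "continuous_on (sphere 0 R) f" "R > 0"
  shows "continuous_on S (\<lambda>t. f (of_real R * cis t))"
  by (rule continuous_on_compose2[OF assms(1)])
     (use assms in \<open>auto intro!: continuous_intros simp: norm_mult cis_conv_exp\<close>)

lemma Re_mean_value:
  assumes "h holomorphic_on ball 0 R'" "0 < R" "R < R'"
  shows "integral {0..2 * pi} (\<lambda>t. Re (h (of_real R * cis t))) = 2 * pi * Re (h 0)"
proof -
  have "h holomorphic_on cball 0 R"
    using assms by (auto elim: holomorphic_on_subset)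
  from Cauchy_integral_circlepath_simple[OF this, of 0] assms
  have "((\<lambda>u. h u / u) has_contour_integral \<i> * (2 * of_real pi * h 0)) (circlepath 0 R)"
    by (simp add: mult_ac)
  from circlepath_integral_has_integral[OF this] assms(2)
  have "((\<lambda>t. h (of_real R * cis t)) has_integral 2 * of_real pi * h 0) {0..2 * pi}" by simp
  from has_integral_Re[OF this] have "((\<lambda>t. Re (h (of_real R * cis t))) has_integral 2 * pi * Re (h 0)) {0..2 * pi}"
    by simp
  thus ?thesis by (rule integral_unique)
qed

text \<open>On the circle the antiholomorphic part \<open>cnj h\<close> does not contribute to Cauchy's formula for
  \<open>deriv h w\<close>, because \<open>R\<^sup>2 = u * cnj u\<close> turns it into the conjugate of the integral of a function
  holomorphic in the disc.\<close>

lemma Schwarz_integral_deriv: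
  assumes h: "h holomorphic_on ball 0 R'" and R: "0 < R" "R < R'" and w: "norm w < R"
  shows "((\<lambda>t. of_real (Re (h (of_real R * cis t))) * (of_real R * cis t) / (of_real R * cis t - w)\<^sup>2)
           has_integral of_real pi * deriv h w) {0..2 * pi}"
proof -
  define c where "c t = of_real R * cis t" for t :: real
  have holc: "h holomorphic_on cball 0 R"
    using assms by (auto elim: holomorphic_on_subset)
  have cw: "c t \<noteq> w" for t using w R by (auto simp: c_def norm_mult)
  have cn: "c t * cnj (c t) = of_real (R\<^sup>2)" for t
    by (simp add: c_def power2_eq_square mult_ac cis_cnj flip: cis_mult)
       (simp add: cis_cnj cis_mult)
  have "(\<lambda>u. h u / (u - w)\<^sup>2) contour_integrable_on circlepath 0 R"
    using holc w ball_subset_cball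
    by (intro Cauchy_derivative_integral_circlepath(1))
       (auto intro: holomorphic_on_imp_continuous_on holomorphic_on_subset)
  moreover have "contour_integral (circlepath 0 R) (\<lambda>u. h u / (u - w)\<^sup>2) = 2 * pi * \<i> * deriv h w"
    using holc w by (intro Cauchy_contour_integral_circlepath_2)
      (auto intro: holomorphic_on_imp_continuous_on holomorphic_on_subset)
  ultimately have "((\<lambda>u. h u / (u - w)\<^sup>2) has_contour_integral 2 * pi * \<i> * deriv h w) (circlepath 0 R)"
    using has_contour_integral_integral by metis
  hence "((\<lambda>u. h u / (u - w)\<^sup>2) has_contour_integral \<i> * (2 * pi * deriv h w)) (circlepath 0 R)"
    by (simp add: mult_ac)
  from circlepath_integral_has_integral[OF this]
  have 1: "((\<lambda>t. h (c t) / (c t - w)\<^sup>2 * c t) has_integral 2 * pi * deriv h w) {0..2 * pi}"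
    by (simp add: c_def mult_ac)
  have nz: "of_real (R\<^sup>2) - cnj w * u \<noteq> 0" if "u \<in> cball 0 R" for u
  proof
    assume "of_real (R\<^sup>2) - cnj w * u = 0"
    hence "norm (cnj w * u) = R\<^sup>2" using R by (metis eq_iff_diff_eq_0 norm_of_real abs_power2)
    moreover have "norm (cnj w * u) \<le> norm w * R"
      using that by (auto simp: norm_mult intro: mult_left_mono)
    moreover have "norm w * R < R\<^sup>2" using w R by (simp add: power2_eq_square)
    ultimately show False by simp
  qed
  \<comment> \<open>The only possible pole, \<open>of_real (R\<^sup>2) / cnj w\<close>, lies outside
    the closed disc, so Cauchy's theorem applies. Conjugation and multiplication by R^2 then turn
    this vanishing integral into that of the antiholomorphic part against the original
    kernel.\<close>
  have "((\<lambda>u. h u / (of_real (R\<^sup>2) - cnj w * u)\<^sup>2) has_contour_integral \<i> * 0) (circlepath 0 R)"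
    unfolding mult_zero_right
  proof (rule Cauchy_theorem_convex_simple[of _ "cball 0 R"])
    show "(\<lambda>u. h u / (of_real (R\<^sup>2) - cnj w * u)\<^sup>2) holomorphic_on cball 0 R"
      using nz by (auto intro!: holomorphic_intros holc)
  qed (use R in auto)
  from circlepath_integral_has_integral[OF this]
  have "((\<lambda>t. h (c t) / (of_real (R\<^sup>2) - cnj w * c t)\<^sup>2 * c t) has_integral 0) {0..2 * pi}"
    by (simp add: c_def)
  from has_integral_mult_right[OF has_integral_cnj[THEN iffD2, OF this], of "of_real (R\<^sup>2)"]
  have "((\<lambda>t. of_real (R\<^sup>2) * cnj (h (c t) / (of_real (R\<^sup>2) - cnj w * c t)\<^sup>2 * c t)) has_integral 0) {0..2 * pi}"
    by (simp add: o_def)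
  moreover have "of_real (R\<^sup>2) * cnj (h (c t) / (of_real (R\<^sup>2) - cnj w * c t)\<^sup>2 * c t)
      = cnj (h (c t)) / (c t - w)\<^sup>2 * c t" for t
  proof -
    have c0: "cnj (c t) \<noteq> 0" using R by (simp add: c_def)
    have "of_real (R\<^sup>2) - w * cnj (c t) = cnj (c t) * (c t - w)"
      unfolding cn[of t, symmetric] by (simp add: algebra_simps)
    hence "of_real (R\<^sup>2) * cnj (h (c t) / (of_real (R\<^sup>2) - cnj w * c t)\<^sup>2 * c t)
        = (c t * cnj (c t)) * (cnj (h (c t)) / (cnj (c t) * (c t - w))\<^sup>2 * cnj (c t))"
      by (simp add: cn)
    also have "\<dots> = cnj (h (c t)) / (c t - w)\<^sup>2 * c t"
    proof -
      have "(a * b) * (H / (b * d)\<^sup>2 * b) = H / d\<^sup>2 * a" if "b \<noteq> 0" for a b d H :: complex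
        using that by (simp add: power_mult_distrib power2_eq_square[of b])
      thus ?thesis using c0 .
    qed
    finally show ?thesis .
  qed
  ultimately have 2: "((\<lambda>t. cnj (h (c t)) / (c t - w)\<^sup>2 * c t) has_integral 0) {0..2 * pi}" by simp
  have eq: "h z / a * b + cnj (h z) / a * b = 2 * (of_real (Re (h z)) * b / a)" for z a b
  proof -
    have "h z / a * b + cnj (h z) / a * b = (h z + cnj (h z)) * b / a"
      by (simp add: add_divide_distrib distrib_right)
    thus ?thesis by (simp add: complex_add_cnj)
  qed
  from has_integral_mult_right[OF has_integral_add[OF 1 2], of "1 / 2"]
  show ?thesis unfolding eq by (simp add: c_def)
qed

text \<open>Only the mean of \<bar>Re h\<bar> enters, not a bound for h itself. This suits the
  zero-free factor of f, whose logarithm is known on the circle only through its real part ln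
  \<bar>f\<bar>.\<close>

lemma norm_deriv_le_Re_mean:
  assumes h: "h holomorphic_on ball 0 R'" and R: "0 < R" "R < R'" and w: "norm w < R"
  shows "norm (deriv h w) \<le> R / (pi * (R - norm w)\<^sup>2) * integral {0..2 * pi} (\<lambda>t. \<bar>Re (h (of_real R * cis t))\<bar>)"
proof -
  define c where "c t = of_real R * cis t" for t :: real
  define K where "K = R / (R - norm w)\<^sup>2"
  have "continuous_on (sphere 0 R) h"
    using h R by (auto intro!: holomorphic_on_imp_continuous_on elim: holomorphic_on_subset)
  hence "continuous_on {0..2 * pi} (\<lambda>t. h (c t))"
    unfolding c_def using R by (intro continuous_on_circle)
  hence "(\<lambda>t. \<bar>Re (h (c t))\<bar>) integrable_on {0..2 * pi}"
    by (intro integrable_continuous_interval continuous_intros)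
  from has_integral_mult_right[OF integrable_integral[OF this], of K]
  have K: "((\<lambda>t. K * \<bar>Re (h (c t))\<bar>) has_integral K * integral {0..2 * pi} (\<lambda>t. \<bar>Re (h (c t))\<bar>)) {0..2 * pi}" .
  have "norm (of_real (Re (h (c t))) * c t / (c t - w)\<^sup>2) \<le> K * \<bar>Re (h (c t))\<bar>" for t
  proof -
    have "R - norm w \<le> norm (c t - w)"
      using norm_triangle_ineq2[of "c t" w] R by (simp add: c_def norm_mult)
    hence "(R - norm w)\<^sup>2 \<le> (norm (c t - w))\<^sup>2" using w by (intro power_mono) auto
    moreover have pos: "(R - norm w)\<^sup>2 > 0" using w by simp
    moreover have "(norm (c t - w))\<^sup>2 > 0" using calculation by linarith
    ultimately have "\<bar>Re (h (c t))\<bar> * R / (norm (c t - w))\<^sup>2 \<le> \<bar>Re (h (c t))\<bar> * R / (R - norm w)\<^sup>2"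
      using R by (intro divide_left_mono mult_nonneg_nonneg mult_pos_pos) auto
    thus ?thesis using R by (simp add: K_def norm_mult norm_divide norm_power c_def mult_ac)
  qed
  from integral_norm_bound_integral[OF has_integral_integrable[OF Schwarz_integral_deriv[OF assms, folded c_def]]
    has_integral_integrable[OF K] this]
  have "norm (of_real pi * deriv h w) \<le> K * integral {0..2 * pi} (\<lambda>t. \<bar>Re (h (c t))\<bar>)"
    using integral_unique[OF Schwarz_integral_deriv[OF assms, folded c_def]] integral_unique[OF K] by simp
  hence "norm (deriv h w) \<le> K * integral {0..2 * pi} (\<lambda>t. \<bar>Re (h (c t))\<bar>) / pi"
    by (simp add: norm_mult pos_le_divide_eq mult.commute)
  thus ?thesis by (simp add: K_def c_def mult_ac)
qed

section \<open>Factoring out the zeros and poles in a disc\<close>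

definition blaschke :: "real \<Rightarrow> complex \<Rightarrow> complex \<Rightarrow> complex" where
  "blaschke R a z = of_real R * (z - a) / (of_real (R\<^sup>2) - cnj a * z)"

lemma blaschke_denom_nonzero:
  assumes "norm a < R" "norm z \<le> R"
  shows "of_real (R\<^sup>2) - cnj a * z \<noteq> 0"
proof
  assume "of_real (R\<^sup>2) - cnj a * z = 0"
  hence "norm (cnj a * z) = norm (of_real (R\<^sup>2) :: complex)" by simp
  hence "norm a * norm z = R\<^sup>2" by (simp only: norm_mult norm_of_real complex_mod_cnj abs_power2)
  moreover have "norm a * norm z \<le> norm a * R" using assms by (intro mult_left_mono) auto
  moreover have "R > 0" using assms norm_ge_zero[of a] by linarith
  hence "norm a * R < R\<^sup>2" using assms by (simp add: power2_eq_square)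
  ultimately show False by simp
qed

lemma blaschke_eq_0_iff:
  assumes "norm a < R" "norm z \<le> R"
  shows "blaschke R a z = 0 \<longleftrightarrow> z = a"
  using blaschke_denom_nonzero[OF assms] assms norm_ge_zero[of a]
  by (auto simp: blaschke_def)

lemma norm_blaschke_circle:
  assumes "norm a < R" "norm z = R"
  shows "norm (blaschke R a z) = 1"
proof -
  have R: "R > 0" using assms norm_ge_zero[of a] by linarith
  have "of_real (R\<^sup>2) = z * cnj z" using assms complex_norm_square[of z] by simp
  hence "of_real (R\<^sup>2) - cnj a * z = z * cnj (z - a)" by (simp add: algebra_simps)
  hence "norm (of_real (R\<^sup>2) - cnj a * z) = R * norm (z - a)"
    using assms by (simp add: norm_mult flip: complex_cnj_diff)
  moreover have "z \<noteq> a" using assms by auto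
  ultimately show ?thesis using R by (simp add: blaschke_def norm_divide norm_mult del: of_real_power)
qed

section \<open>Zeros and poles of nicely meromorphic functions\<close>

lemma nicely_meromorphic_nonzero_cosparse:
  assumes "f nicely_meromorphic_on UNIV" "\<exists>z. f z \<noteq> 0"
  shows "{z. f z = 0} sparse_in UNIV"
  using nicely_meromorphic_imp_constant_or_avoid[OF assms(1), of 0] assms(2)
  by (auto simp: eventually_cosparse)

lemma nicely_meromorphic_eventually_nonzero:
  assumes "f nicely_meromorphic_on UNIV" "\<exists>z. f z \<noteq> 0"
  shows "eventually (\<lambda>w. f w \<noteq> 0) (at z)"
  using nicely_meromorphic_nonzero_cosparse[OF assms]
  by (auto simp: sparse_in_def islimpt_iff_eventually)

lemma nicely_meromorphic_finite_zeros:
  assumes "f nicely_meromorphic_on UNIV" "\<exists>z. f z \<noteq> 0" "bounded A"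
  shows "finite {z\<in>A. f z = 0}"
proof -
  have "compact (closure A)" using assms by simp
  hence "finite (closure A \<inter> {z. f z = 0})"
    using nicely_meromorphic_nonzero_cosparse[OF assms(1,2)]
    by (intro sparse_in_compact_finite) (auto intro: sparse_in_subset)
  thus ?thesis by (rule finite_subset[rotated]) (use closure_subset in auto)
qed

lemma is_pole_imp_zero:
  assumes "f nicely_meromorphic_on UNIV" "is_pole f z"
  shows "f z = 0"
  using is_pole_zero_at_nicely_mero[OF assms] by simp

lemma nicely_meromorphic_analytic_at:
  assumes "f nicely_meromorphic_on UNIV" "f z \<noteq> 0"
  shows "f analytic_on {z}"
  using assms is_pole_imp_zero by (intro nicely_meromorphic_on_imp_analytic_at[of f UNIV]) auto

lemma zorder_eq_0_nicely_meromorphic: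
  assumes "f nicely_meromorphic_on UNIV" "f z \<noteq> 0"
  shows "zorder f z = 0"
  using nicely_meromorphic_analytic_at[OF assms] assms(2) by (rule zorder_eq_0I)

text \<open>The Blaschke powers have the same order as f at every point of the closed disc, so the
  quotient, with removable singularities filled in, has neither zeros nor poles there. By finiteness
  this persists on a slightly larger disc, where a holomorphic logarithm h exists. The larger disc
  makes h holomorphic across the circle, where the mean value and Schwarz formulas are
  applied.\<close>

lemma blaschke_factorization:
  fixes f :: "complex \<Rightarrow> complex" and R :: real
  assumes f: "f nicely_meromorphic_on UNIV" "\<exists>z. f z \<noteq> 0" and R: "R > 0"
    and circ: "\<And>z. norm z = R \<Longrightarrow> f z \<noteq> 0"
  defines "A \<equiv> {z\<in>ball 0 R. f z = 0}"
  obtains R' h where "R' > R" "h holomorphic_on ball 0 R'"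
    "\<And>z. norm z \<le> R \<Longrightarrow> f z \<noteq> 0 \<Longrightarrow> f z = (\<Prod>a\<in>A. blaschke R a z powi zorder f a) * exp (h z)"
proof -
  have mero: "f meromorphic_on X" for X
    using f by (auto simp: nicely_meromorphic_on_def intro: meromorphic_on_subset)
  have finA: "finite A" unfolding A_def using f by (intro nicely_meromorphic_finite_zeros) auto
  have evf: "eventually (\<lambda>w. f w \<noteq> 0) (at z)" for z
    using nicely_meromorphic_eventually_nonzero[OF f] .
  define P where "P z = (\<Prod>a\<in>A. blaschke R a z powi zorder f a)" for z
  have blm: "blaschke R a meromorphic_on X" for a X
    unfolding blaschke_def by (intro meromorphic_intros)
  have Pm: "P meromorphic_on X" for X
    unfolding P_def by (intro meromorphic_intros blm)
  have bla: "blaschke R a analytic_on {z}" if "a \<in> A" "norm z \<le> R" for a z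
    unfolding blaschke_def using that blaschke_denom_nonzero[of a R z]
    by (intro analytic_intros) (auto simp: A_def)
  have evbl: "eventually (\<lambda>w. blaschke R a w \<noteq> 0) (at z)" if "a \<in> A" "norm z \<le> R" for a z
  proof -
    have "eventually (\<lambda>w. of_real (R\<^sup>2) - cnj a * w \<noteq> 0) (at z)"
      by (rule tendsto_imp_eventually_ne[OF _ blaschke_denom_nonzero[of a R z]])
         (use that in \<open>auto simp: A_def intro!: tendsto_eq_intros\<close>)
    moreover have "eventually (\<lambda>w. w \<noteq> a) (at z)"
      by (rule eventually_neq_at_within)
    ultimately show ?thesis
      by eventually_elim (use R in \<open>auto simp: blaschke_def\<close>)
  qed
  have evP: "eventually (\<lambda>w. P w \<noteq> 0) (at z)" if "norm z \<le> R" for z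
  proof -
    have "eventually (\<lambda>w. \<forall>a\<in>A. blaschke R a w \<noteq> 0) (at z)"
      using evbl that finA by (intro eventually_ball_finite) auto
    thus ?thesis by eventually_elim (use finA in \<open>auto simp: P_def\<close>)
  qed
  have zob: "zorder (blaschke R a) z = (if z = a then 1 else 0)" if "a \<in> A" "norm z \<le> R" for a z
  proof (cases "z = a")
    case True
    have nz: "of_real (R\<^sup>2) - cnj a * a \<noteq> 0"
      using blaschke_denom_nonzero[of a R a] that by (auto simp: A_def)
    have "zorder (blaschke R a) a = 1"
    proof (rule zorder_eqI)
      show "open {w. of_real (R\<^sup>2) - cnj a * w \<noteq> 0}"
        by (intro open_Collect_neq continuous_intros)
      show "(\<lambda>w. of_real R / (of_real (R\<^sup>2) - cnj a * w)) holomorphic_on {w. of_real (R\<^sup>2) - cnj a * w \<noteq> 0}"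
        by (intro holomorphic_intros) auto
    qed (use nz R in \<open>auto simp: blaschke_def\<close>)
    thus ?thesis using True by simp
  next
    case False
    hence "blaschke R a z \<noteq> 0" using blaschke_eq_0_iff[of a R z] that by (auto simp: A_def)
    thus ?thesis using False bla[OF that] by (simp add: zorder_eq_0I)
  qed
  have zoP: "zorder P z = zorder f z" if "norm z \<le> R" for z
  proof -
    have "zorder P z = (\<Sum>a\<in>A. zorder (\<lambda>z. blaschke R a z powi zorder f a) z)"
      unfolding P_def using evP[OF that]
      by (intro zorder_prod) (auto simp: P_def intro!: meromorphic_intros blm)
    also have "\<dots> = (\<Sum>a\<in>A. zorder f a * (if z = a then 1 else 0))"
      using that by (intro sum.cong refl)
        (simp add: zorder_power_int blm evbl eventually_frequently flip: zob)
    also have "\<dots> = (if z \<in> A then zorder f z else 0)"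
      using finA by (simp add: if_distrib sum.delta cong: if_cong)
    also have "\<dots> = zorder f z"
    proof (cases "z \<in> A")
      case False
      hence "f z \<noteq> 0" using that circ[of z] by (auto simp: A_def)
      thus ?thesis using zorder_eq_0_nicely_meromorphic[OF f(1)] False by simp
    qed auto
    finally show ?thesis .
  qed
  \<comment> \<open>At the points of \<open>A\<close> the pointwise quotient is 0 / 0, evaluated as
    0; \<open>remove_sings\<close> puts in the limits.\<close>
  define g where "g = remove_sings (\<lambda>z. f z / P z)"
  have fPm: "(\<lambda>z. f z / P z) meromorphic_on X" for X
    by (intro meromorphic_intros mero Pm)
  have gn: "g nicely_meromorphic_on UNIV"
    unfolding g_def by (intro remove_sings_nicely_meromorphic fPm)
  have zog: "zorder g z = 0" if "norm z \<le> R" for z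
  proof -
    have "zorder g z = zorder (\<lambda>z. f z / P z) z"
      unfolding g_def using fPm[of "{z}"] by (simp add: meromorphic_at_iff)
    also have "\<dots> = zorder f z - zorder P z"
      by (intro zorder_divide mero Pm)
         (use evf evP[OF that] in \<open>auto intro: eventually_frequently\<close>)
    finally show ?thesis using zoP[OF that] by simp
  qed
  have evg: "eventually (\<lambda>w. g w \<noteq> 0 \<and> g w = f w / P w) (at z)" if "norm z \<le> R" for z
  proof -
    have "eventually (\<lambda>w. g w = f w / P w) (at z)"
      unfolding g_def using fPm[of "{z}"]
      by (intro eventually_remove_sings_eq_at) (auto simp: meromorphic_at_iff)
    thus ?thesis using evf[of z] evP[OF that] by eventually_elim auto
  qed
  have gnz0: "\<exists>z. g z \<noteq> 0"
    using eventually_happens[OF evg[of 0]] R by auto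
  have gnz: "g z \<noteq> 0" "\<not> is_pole g z" if "norm z \<le> R" for z
  proof -
    have m: "g meromorphic_on {z}"
      using gn by (auto simp: nicely_meromorphic_on_def intro: meromorphic_on_subset)
    have "\<not> isolated_zero g z"
      using zorder_isolated_zero_pos'[of g z] m zog[OF that] by (auto simp: meromorphic_at_iff)
    moreover show "\<not> is_pole g z"
      using isolated_pole_imp_neg_zorder[of g z] m zog[OF that] by (auto simp: meromorphic_at_iff)
    moreover have "eventually (\<lambda>w. g w \<noteq> 0) (at z)"
      using evg[OF that] by (rule eventually_mono) blast
    ultimately show "g z \<noteq> 0"
      using zero_or_pole[OF gn, of z] by auto
  qed
  have "finite {z\<in>cball 0 (R + 1). g z = 0}"
    using gn gnz0 by (intro nicely_meromorphic_finite_zeros) auto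
  define Z where "Z = norm ` {z\<in>cball 0 (R + 1). g z = 0}"
  have finZ: "finite Z" unfolding Z_def by (intro finite_imageI) fact
  have ZR: "x > R" if "x \<in> Z" for x
    using that gnz(1) by (force simp: Z_def not_le[symmetric])
  \<comment> \<open>Since \<open>g\<close> is nicely meromorphic, it takes the value 0 at its poles
    too. A disc that stops at the nearest zero value therefore contains neither zeros nor poles; the
    cap R + 1 confines the search to a bounded set.\<close>
  define R' where "R' = Min (insert (R + 1) Z)"
  have R': "R' > R" "R' \<le> R + 1" unfolding R'_def using finZ ZR by auto
  have gnz': "g z \<noteq> 0" if "z \<in> ball 0 R'" for z
  proof
    assume "g z = 0"
    hence "norm z \<in> Z" unfolding Z_def using that R' by auto
    hence "R' \<le> norm z" unfolding R'_def using finZ by auto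
    thus False using that by simp
  qed
  have "g analytic_on ball 0 R'"
    by (subst analytic_on_analytic_at) (intro ballI nicely_meromorphic_analytic_at[OF gn] gnz')
  hence "g holomorphic_on ball 0 R'" by (rule analytic_imp_holomorphic)
  then obtain h where h: "h holomorphic_on ball 0 R'" "\<And>z. z \<in> ball 0 R' \<Longrightarrow> exp (h z) = g z"
    using holomorphic_logarithm_exists[of "ball 0 R'" g 0] gnz' R R'(1) by auto
  show ?thesis
  proof (rule that[OF R'(1) h(1)])
    fix z assume z: "norm z \<le> R" "f z \<noteq> 0"
    have Pz: "P analytic_on {z}" "P z \<noteq> 0"
    proof -
      have nz: "blaschke R a z \<noteq> 0" if "a \<in> A" for a
        using that z by (subst blaschke_eq_0_iff) (auto simp: A_def)
      show "P analytic_on {z}"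
        unfolding P_def using z bla nz by (intro analytic_intros) auto
      show "P z \<noteq> 0" unfolding P_def using nz finA by auto
    qed
    have "f analytic_on {z}"
      by (rule nicely_meromorphic_analytic_at[OF f(1) z(2)])
    hence "(\<lambda>z. f z / P z) analytic_on {z}" using Pz by (intro analytic_intros) auto
    hence "g z = f z / P z" unfolding g_def by (rule remove_sings_at_analytic)
    thus "f z = (\<Prod>a\<in>A. blaschke R a z powi zorder f a) * exp (h z)"
      using h(2)[of z] z R' Pz(2) by (simp add: P_def field_simps)
  qed
qed

section \<open>Jensen's formula and the Nevanlinna characteristic\<close>

locale nonzero_meromorphic =
  fixes f :: "complex \<Rightarrow> complex"
  assumes nicely: "f nicely_meromorphic_on UNIV"
    and nonzero: "\<exists>z. f z \<noteq> 0"
begin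

text \<open>A nicely meromorphic function takes the value \<open>0\<close> at its poles, so this is the set of zeros
  and poles.\<close>

definition zeros_poles :: "real \<Rightarrow> complex set" where
  "zeros_poles R = {z\<in>ball 0 R. f z = 0}"

text \<open>On a circle without zeros and poles this is m(R, f) + m(R, 1 / f).\<close>

definition log_mean :: "real \<Rightarrow> real" where
  "log_mean R = 1 / (2 * pi) * integral {0..2 * pi} (\<lambda>t. \<bar>ln (norm (f (of_real R * cis t)))\<bar>)"

lemma finite_zeros_poles: "finite (zeros_poles R)"
  unfolding zeros_poles_def by (intro nicely_meromorphic_finite_zeros nicely nonzero) auto

lemma meromorphic: "f meromorphic_on X"
  using nicely by (auto simp: nicely_meromorphic_on_def intro: meromorphic_on_subset)

lemma eventually_nonzero: "eventually (\<lambda>w. f w \<noteq> 0) (at z)"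
  by (rule nicely_meromorphic_eventually_nonzero[OF nicely nonzero])

lemma continuous_on_circle_ln:
  assumes "\<And>z. norm z = R \<Longrightarrow> f z \<noteq> 0" "R > 0"
  shows "continuous_on S (\<lambda>t. ln (norm (f (of_real R * cis t))))"
proof -
  have an: "f analytic_on sphere 0 R"
    using assms
    by (subst analytic_on_analytic_at) (auto intro!: nicely_meromorphic_analytic_at[OF nicely])
  have "continuous_on S (\<lambda>t. f (of_real R * cis t))"
    by (intro continuous_on_circle analytic_imp_holomorphic[OF an, THEN holomorphic_on_imp_continuous_on] assms)
  thus ?thesis
    using assms by (intro continuous_intros) (auto simp: norm_mult)
qed

text \<open>On the circle all Blaschke factors have modulus 1, so ln \<bar>f\<bar> = Re h there and
  the mean is Re (h 0). That value is read off at the origin by comparing the factorization with the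
  leading Laurent coefficient \<open>zor_poly f 0 0\<close>. Poles enter through the negative sign
  of \<open>zorder\<close>.\<close>

lemma jensen:
  assumes R: "R > 0" and circ: "\<And>z. norm z = R \<Longrightarrow> f z \<noteq> 0"
  shows "1 / (2 * pi) * integral {0..2 * pi} (\<lambda>t. ln (norm (f (of_real R * cis t))))
       = ln (norm (zor_poly f 0 0)) + of_int (zorder f 0) * ln R
         + (\<Sum>a\<in>zeros_poles R - {0}. of_int (zorder f a) * ln (R / norm a))"
proof -
  obtain R' h where h: "R' > R" "h holomorphic_on ball 0 R'"
    "\<And>z. norm z \<le> R \<Longrightarrow> f z \<noteq> 0 \<Longrightarrow> f z = (\<Prod>a\<in>zeros_poles R. blaschke R a z powi zorder f a) * exp (h z)"
    using blaschke_factorization[OF nicely nonzero R circ] unfolding zeros_poles_def by blast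
  have "ln (norm (f (of_real R * cis t))) = Re (h (of_real R * cis t))" for t
  proof -
    define z where "z = of_real R * cis t"
    have z: "norm z = R" using R by (simp add: z_def norm_mult)
    hence "norm (f z) = norm ((\<Prod>a\<in>zeros_poles R. blaschke R a z powi zorder f a) * exp (h z))"
      using h(3)[of z] circ[of z] by simp
    also have "\<dots> = exp (Re (h z))"
      using z by (simp add: norm_mult prod_norm[symmetric] norm_power_int norm_blaschke_circle zeros_poles_def)
    finally show ?thesis by (simp add: z_def)
  qed
  hence mean: "1 / (2 * pi) * integral {0..2 * pi} (\<lambda>t. ln (norm (f (of_real R * cis t)))) = Re (h 0)"
    using Re_mean_value[OF h(2) R h(1)] by simp
  define k where "k = zorder f 0"
  define B where "B = zeros_poles R - {0}"
  define Q where "Q z = (\<Prod>a\<in>B. blaschke R a z powi zorder f a)" for z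
  \<comment> \<open>The Blaschke factor at the origin is z / R. If the origin is neither a zero nor
    a pole, then k = 0 and the split-off power is 1.\<close>
  have prodQ: "(\<Prod>a\<in>zeros_poles R. blaschke R a z powi zorder f a) = (z / of_real R) powi k * Q z" for z
  proof (cases "0 \<in> zeros_poles R")
    case True
    thus ?thesis using finite_zeros_poles R
      by (simp add: Q_def B_def k_def prod.remove[of _ 0] blaschke_def power2_eq_square)
  next
    case False
    hence "f 0 \<noteq> 0" using R by (simp add: zeros_poles_def)
    hence "k = 0" unfolding k_def by (rule zorder_eq_0_nicely_meromorphic[OF nicely])
    thus ?thesis using False by (simp add: Q_def B_def)
  qed
  have Bn: "norm a < R" "a \<noteq> 0" if "a \<in> B" for a using that by (auto simp: B_def zeros_poles_def)
  have bl0: "blaschke R a 0 = - a / of_real R" for a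
    using R by (simp add: blaschke_def power2_eq_square)
  have lim: "((\<lambda>z. of_real R powi (- k) * Q z * exp (h z)) \<longlongrightarrow> of_real R powi (- k) * Q 0 * exp (h 0)) (at 0)"
  proof -
    have "isCont h 0"
      using h R by (intro holomorphic_on_imp_continuous_on[THEN continuous_on_interior]) auto
    moreover have "isCont Q 0"
      unfolding Q_def blaschke_def using R Bn
      by (intro continuous_intros) (auto simp: power2_eq_square)
    ultimately have "isCont (\<lambda>z. of_real R powi (- k) * Q z * exp (h z)) 0"
      by (intro continuous_intros)
    thus ?thesis by (simp add: isCont_def)
  qed
  \<comment> \<open>Near the origin, multiplying f by z to the power -k cancels the split-off power
    of z. What remains is continuous at 0, so the coefficient is its value there.\<close>
  have "zor_poly f 0 0 = of_real R powi (- k) * Q 0 * exp (h 0)"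
  proof (rule zor_poly_eqI)
    show "isolated_singularity_at f 0" "not_essential f 0"
      using meromorphic[of "{0}"] by (auto simp: meromorphic_at_iff)
    show "\<exists>\<^sub>F w in at 0. f w \<noteq> 0" using eventually_nonzero by (simp add: eventually_frequently)
    show "filterlim (\<lambda>x. x) (at 0) (at (0::complex))" by (rule filterlim_ident)
    have "eventually (\<lambda>z. z \<in> ball 0 R - {0}) (at (0::complex))"
      using R by (intro eventually_at_in_open) auto
    hence "eventually (\<lambda>z. of_real R powi (- k) * Q z * exp (h z) = f z * (z - 0) powi - zorder f 0) (at 0)"
      using eventually_nonzero[of 0]
    proof eventually_elim
      case (elim z)
      have "f z = (z / of_real R) powi k * Q z * exp (h z)"
        using h(3)[of z] elim by (simp add: prodQ)
      thus ?case using elim R by (simp add: power_int_divide_distrib power_int_minus field_simps flip: k_def)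
    qed
    thus "((\<lambda>z. f z * (z - 0) powi - zorder f 0) \<longlongrightarrow> of_real R powi (- k) * Q 0 * exp (h 0)) (at 0)"
      using lim by (rule Lim_transform_eventually[rotated])
  qed auto
  hence "norm (zor_poly f 0 0) = R powi (- k) * (\<Prod>a\<in>B. (norm a / R) powi zorder f a) * exp (Re (h 0))"
    using R by (simp add: norm_mult norm_power_int Q_def prod_norm[symmetric] bl0 norm_divide)
  also have "ln \<dots> = ln (R powi (- k)) + (\<Sum>a\<in>B. ln ((norm a / R) powi zorder f a)) + Re (h 0)"
  proof -
    have "(norm a / R) powi zorder f a > 0" if "a \<in> B" for a
      using Bn[OF that] R by simp
    hence "(norm a / R) powi zorder f a \<noteq> 0" if "a \<in> B" for a
      using that by fastforce
    moreover from this have "(\<Prod>a\<in>B. (norm a / R) powi zorder f a) \<noteq> 0"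
      using finite_zeros_poles by (simp add: B_def)
    moreover have "finite B" using finite_zeros_poles by (simp add: B_def)
    ultimately show ?thesis
      using R by (simp add: ln_mult ln_prod)
  qed
  also have "ln (R powi (- k)) = - of_int k * ln R"
    using R by (simp add: powr_real_of_int' [symmetric] ln_powr)
  also have "(\<Sum>a\<in>B. ln ((norm a / R) powi zorder f a)) = (\<Sum>a\<in>B. - (of_int (zorder f a) * ln (R / norm a)))"
  proof (intro sum.cong refl)
    fix a assume "a \<in> B"
    hence "norm a / R > 0" using R Bn by simp
    thus "ln ((norm a / R) powi zorder f a) = - (of_int (zorder f a) * ln (R / norm a))"
      using R Bn[OF \<open>a \<in> B\<close>] by (simp add: powr_real_of_int' [symmetric] ln_powr ln_div algebra_simps)
  qed
  finally show ?thesis unfolding mean by (simp add: sum_negf B_def k_def)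
qed

section \<open>The counting function and the first fundamental theorem\<close>

lemma not_pole_zorder_nonneg:
  assumes "\<not> is_pole f a"
  shows "zorder f a \<ge> 0"
  using zorder_neg_imp_is_pole[OF meromorphic eventually_nonzero, of a] assms by (meson not_le)

text \<open>The index set on the right does not depend on t, so the counting integral can be
  evaluated term by term. The origin stands apart because \<open>pole_counting\<close> treats it by
  a separate logarithm.\<close>

lemma pole_count_eq:
  assumes R: "R > 0" and circ: "\<And>z. norm z = R \<Longrightarrow> f z \<noteq> 0" and t: "0 \<le> t" "t \<le> R"
  shows "pole_count t f = nat (- zorder f 0) + (\<Sum>a\<in>zeros_poles R - {0}. if norm a \<le> t then nat (- zorder f a) else 0)"
proof -
  have "pole_count t f = (\<Sum>a | a \<in> insert 0 (zeros_poles R) \<and> norm a \<le> t. nat (- zorder f a))"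
    unfolding pole_count_def
  proof (rule sum.mono_neutral_left)
    show "finite {a \<in> insert 0 (zeros_poles R). norm a \<le> t}" using finite_zeros_poles by simp
    show "{z. norm z \<le> t \<and> is_pole f z} \<subseteq> {a \<in> insert 0 (zeros_poles R). norm a \<le> t}"
    proof safe
      fix z assume z: "norm z \<le> t" "is_pole f z" "z \<notin> zeros_poles R"
      have "f z = 0" using is_pole_imp_zero[OF nicely] z by auto
      hence "norm z < R" using z t circ[of z] by (cases "norm z = R") auto
      thus "z = 0" using z \<open>f z = 0\<close> by (auto simp: zeros_poles_def)
    qed
    show "\<forall>a\<in>{a \<in> insert 0 (zeros_poles R). norm a \<le> t} - {z. norm z \<le> t \<and> is_pole f z}. nat (- zorder f a) = 0"
      using not_pole_zorder_nonneg by auto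
  qed
  also have "{a. a \<in> insert 0 (zeros_poles R) \<and> norm a \<le> t} = insert 0 {a\<in>zeros_poles R - {0}. norm a \<le> t}"
    using t by auto
  also have "(\<Sum>a\<in>\<dots>. nat (- zorder f a)) = nat (- zorder f 0) + (\<Sum>a\<in>{a\<in>zeros_poles R - {0}. norm a \<le> t}. nat (- zorder f a))"
    using finite_zeros_poles by (subst sum.insert) auto
  also have "(\<Sum>a\<in>{a\<in>zeros_poles R - {0}. norm a \<le> t}. nat (- zorder f a))
     = (\<Sum>a\<in>zeros_poles R - {0}. if norm a \<le> t then nat (- zorder f a) else 0)"
    using finite_zeros_poles by (intro sum.inter_filter) auto
  finally show ?thesis .
qed

text \<open>This is the contribution of one pole of multiplicity m at distance c: it is counted from
  t = c onwards.\<close>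

lemma has_integral_cutoff_inverse:
  fixes c R m :: real
  assumes "0 < c" "c \<le> R"
  shows "((\<lambda>t. if c \<le> t then m / t else 0) has_integral m * ln (R / c)) {0..R}"
proof -
  have "((\<lambda>t. m / t) has_integral m * ln R - m * ln c) {c..R}"
    using assms by (intro fundamental_theorem_of_calculus)
      (auto intro!: derivative_eq_intros simp: has_real_derivative_iff_has_vector_derivative[symmetric])
  hence "((\<lambda>t. if t \<in> {c..R} then m / t else 0) has_integral m * ln R - m * ln c) {0..R}"
    using assms by (subst has_integral_restrict) auto
  hence "((\<lambda>t. if c \<le> t then m / t else 0) has_integral m * ln R - m * ln c) {0..R}"
    by (rule has_integral_eq[rotated]) auto
  thus ?thesis using assms by (simp add: ln_div right_diff_distrib)
qed

lemma pole_counting_eq: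
  assumes R: "R > 0" and circ: "\<And>z. norm z = R \<Longrightarrow> f z \<noteq> 0"
  shows "pole_counting R f = (\<Sum>a\<in>zeros_poles R - {0}. real (nat (- zorder f a)) * ln (R / norm a))
           + real (nat (- zorder f 0)) * ln R"
proof -
  have p0: "pole_count 0 f = nat (- zorder f 0)"
  proof -
    have "(\<Sum>a\<in>zeros_poles R - {0}. if norm a \<le> 0 then nat (- zorder f a) else 0) = 0"
      by (intro sum.neutral) auto
    thus ?thesis using pole_count_eq[OF R circ, of 0] R by simp
  qed
  have "((\<lambda>t. \<Sum>a\<in>zeros_poles R - {0}. if norm a \<le> t then real (nat (- zorder f a)) / t else 0)
      has_integral (\<Sum>a\<in>zeros_poles R - {0}. real (nat (- zorder f a)) * ln (R / norm a))) {0..R}"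
    using finite_zeros_poles by (intro has_integral_sum has_integral_cutoff_inverse) (auto simp: zeros_poles_def)
  moreover have "(\<Sum>a\<in>zeros_poles R - {0}. if norm a \<le> t then real (nat (- zorder f a)) / t else 0)
      = (real (pole_count t f) - real (pole_count 0 f)) / t" if "t \<in> {0..R}" for t
    using that by (simp add: p0 pole_count_eq[OF R circ] sum_divide_distrib if_distrib[of real]
        if_distrib[of "\<lambda>x. x / t"] cong: if_cong)
  ultimately have "((\<lambda>t. (real (pole_count t f) - real (pole_count 0 f)) / t)
      has_integral (\<Sum>a\<in>zeros_poles R - {0}. real (nat (- zorder f a)) * ln (R / norm a))) {0..R}"
    by (rule has_integral_eq[rotated])
  thus ?thesis unfolding pole_counting_def by (simp add: integral_unique p0)
qed

text \<open>The left side is T(R, f) + T(R, 1 / f) written out, so this is a symmetric, exact form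
  of the first fundamental theorem. It follows from Jensen's formula by \<bar>u\<bar> = 2 max(0, u)
  - u for the mean and \<bar>k\<bar> = k + 2 max(0, -k) for the orders.\<close>

lemma nevanlinna_char_identity:
  assumes R: "R > 0" and circ: "\<And>z. norm z = R \<Longrightarrow> f z \<noteq> 0"
  shows "log_mean R + (\<Sum>a\<in>zeros_poles R - {0}. \<bar>of_int (zorder f a)\<bar> * ln (R / norm a)) + \<bar>of_int (zorder f 0)\<bar> * ln R
    = 2 * nevanlinna_char R f - ln (norm (zor_poly f 0 0))"
proof -
  define u where "u t = ln (norm (f (of_real R * cis t)))" for t
  have cu: "continuous_on {0..2 * pi} u"
    unfolding u_def by (rule continuous_on_circle_ln[OF circ R])
  have ui: "u integrable_on {0..2 * pi}" "(\<lambda>t. max 0 (u t)) integrable_on {0..2 * pi}"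
    by (intro integrable_continuous_interval continuous_intros cu)+
  have "ln_plus (norm (f (of_real R * cis t))) = max 0 (u t)" for t
  proof -
    have "f (of_real R * cis t) \<noteq> 0" using R by (intro circ) (simp add: norm_mult)
    thus ?thesis by (simp add: ln_plus_def u_def max_def)
  qed
  hence prox: "2 * pi * proximity R f = integral {0..2 * pi} (\<lambda>t. max 0 (u t))"
    by (simp add: proximity_def)
  have "2 * pi * log_mean R = integral {0..2 * pi} (\<lambda>t. 2 * max 0 (u t) - u t)"
    unfolding log_mean_def by (simp flip: u_def) (intro integral_cong, auto)
  also have "\<dots> = 2 * (2 * pi * proximity R f) - integral {0..2 * pi} u"
    unfolding prox using ui by (simp add: integral_diff)
  also have "integral {0..2 * pi} u = 2 * pi * (ln (norm (zor_poly f 0 0)) + of_int (zorder f 0) * ln R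
         + (\<Sum>a\<in>zeros_poles R - {0}. of_int (zorder f a) * ln (R / norm a)))"
    using jensen[OF R circ] by (simp add: u_def[abs_def] field_simps)
  finally have "2 * pi * log_mean R = 2 * pi * (2 * proximity R f - (ln (norm (zor_poly f 0 0)) + of_int (zorder f 0) * ln R
         + (\<Sum>a\<in>zeros_poles R - {0}. of_int (zorder f a) * ln (R / norm a))))"
    by (simp add: algebra_simps)
  hence J: "log_mean R = 2 * proximity R f - (ln (norm (zor_poly f 0 0)) + of_int (zorder f 0) * ln R
         + (\<Sum>a\<in>zeros_poles R - {0}. of_int (zorder f a) * ln (R / norm a)))" 
    by (subst (asm) mult_left_cancel) auto
  have abs: "\<bar>real_of_int k\<bar> = of_int k + 2 * real (nat (- k))" for k by auto
  have pc: "pole_counting R f = (\<Sum>a\<in>zeros_poles R - {0}. real (nat (- zorder f a)) * ln (R / norm a))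
           + real (nat (- zorder f 0)) * ln R"
    using R circ by (rule pole_counting_eq)
  show ?thesis unfolding J nevanlinna_char_def pc
    by (simp add: abs distrib_right sum.distrib sum_distrib_left algebra_simps)
qed

lemma log_mean_nonneg: "log_mean R \<ge> 0"
proof -
  have "integral {0..2 * pi} (\<lambda>t. \<bar>ln (norm (f (of_real R * cis t)))\<bar>) \<ge> 0"
    by (cases "(\<lambda>t. \<bar>ln (norm (f (of_real R * cis t)))\<bar>) integrable_on {0..2 * pi}")
       (auto intro: integral_nonneg simp: not_integrable_integral)
  thus ?thesis by (simp add: log_mean_def)
qed

lemma log_mean_le:
  assumes "R \<ge> 1" "\<And>z. norm z = R \<Longrightarrow> f z \<noteq> 0"
  shows "log_mean R \<le> 2 * nevanlinna_char R f - ln (norm (zor_poly f 0 0))"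
proof -
  have "(\<Sum>a\<in>zeros_poles R - {0}. \<bar>of_int (zorder f a)\<bar> * ln (R / norm a)) \<ge> 0"
    by (intro sum_nonneg mult_nonneg_nonneg) (auto simp: zeros_poles_def)
  moreover have "\<bar>of_int (zorder f 0)\<bar> * ln R \<ge> 0" using assms by simp
  moreover have "log_mean R + (\<Sum>a\<in>zeros_poles R - {0}. \<bar>of_int (zorder f a)\<bar> * ln (R / norm a))
      + \<bar>of_int (zorder f 0)\<bar> * ln R = 2 * nevanlinna_char R f - ln (norm (zor_poly f 0 0))"
    using assms by (intro nevanlinna_char_identity) auto
  ultimately show ?thesis by linarith
qed

text \<open>A zero or pole within distance R \<le> S / 2 of the origin has weight ln (S /
  \<bar>a\<bar>) \<ge> ln 2 in the identity for the radius S. The origin has weight ln S, and S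
  \<ge> 2.\<close>

lemma zeros_poles_count_le:
  assumes "R \<ge> 1" "S \<ge> 2 * R" "\<And>z. norm z = S \<Longrightarrow> f z \<noteq> 0"
  shows "ln 2 * (\<Sum>a\<in>zeros_poles R. \<bar>real_of_int (zorder f a)\<bar>) \<le> 2 * nevanlinna_char S f - ln (norm (zor_poly f 0 0))"
proof -
  define m where "m a = \<bar>real_of_int (zorder f a)\<bar>" for a
  \<comment> \<open>Inserting 0 handles both cases at once: if the origin was not in the set, only a
    nonnegative term is added.\<close>
  have "ln 2 * (\<Sum>a\<in>zeros_poles R. m a) \<le> ln 2 * (\<Sum>a\<in>insert 0 (zeros_poles R - {0}). m a)"
    using finite_zeros_poles by (intro mult_left_mono sum_mono2) (auto simp: m_def)
  also have "\<dots> = (\<Sum>a\<in>zeros_poles R - {0}. m a * ln 2) + m 0 * ln 2"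
    using finite_zeros_poles by (subst sum.insert) (auto simp: sum_distrib_left algebra_simps)
  also have "(\<Sum>a\<in>zeros_poles R - {0}. m a * ln 2) \<le> (\<Sum>a\<in>zeros_poles R - {0}. m a * ln (S / norm a))"
  proof (intro sum_mono mult_left_mono)
    fix a assume a: "a \<in> zeros_poles R - {0}"
    hence "2 \<le> S / norm a" using assms by (auto simp: zeros_poles_def field_simps)
    thus "ln 2 \<le> ln (S / norm a)" by simp
  qed (auto simp: m_def)
  also have "(\<Sum>a\<in>zeros_poles R - {0}. m a * ln (S / norm a)) \<le> (\<Sum>a\<in>zeros_poles S - {0}. m a * ln (S / norm a))"
    using finite_zeros_poles assms by (intro sum_mono2) (auto simp: zeros_poles_def m_def)
  also have "m 0 * ln 2 \<le> m 0 * ln S"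
    using assms by (intro mult_left_mono) (auto simp: m_def)
  finally have "ln 2 * (\<Sum>a\<in>zeros_poles R. m a) \<le> (\<Sum>a\<in>zeros_poles S - {0}. m a * ln (S / norm a)) + m 0 * ln S" by simp
  also have "\<dots> \<le> 2 * nevanlinna_char S f - ln (norm (zor_poly f 0 0))"
    using nevanlinna_char_identity[of S] log_mean_nonneg[of S] assms by (simp add: m_def)
  finally show ?thesis by (simp add: m_def)
qed

end

section \<open>Logarithmic differences\<close>

text \<open>This trades a logarithmic singularity for an integrable power, which brings in the gain
  d to the power \<alpha>. For t > 1 it is ln u \<le> u applied to u = (1 + t) to the power
  \<alpha>.\<close>

lemma ln_add_one_le_powr:
  fixes t \<alpha> :: real
  assumes "0 < \<alpha>" "\<alpha> \<le> 1" "t \<ge> 0"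
  shows "ln (1 + t) \<le> 2 / \<alpha> * t powr \<alpha>"
proof (cases "t \<le> 1")
  case True
  have "ln (1 + t) \<le> t" using assms by (simp add: ln_add_one_self_le_self)
  also have "t \<le> t powr \<alpha>"
    using powr_mono'[of \<alpha> 1 t] assms True by (cases "t = 0") auto
  also have "\<dots> \<le> 2 / \<alpha> * t powr \<alpha>"
    using assms mult_right_mono[of 1 "2 / \<alpha>" "t powr \<alpha>"] by simp
  finally show ?thesis .
next
  case False
  have "\<alpha> * ln (1 + t) = ln ((1 + t) powr \<alpha>)" using assms by (simp add: ln_powr)
  also have "\<dots> \<le> (1 + t) powr \<alpha>" using assms ln_bound[of "(1 + t) powr \<alpha>"] by simp
  also have "\<dots> \<le> (2 * t) powr \<alpha>" using assms False by (intro powr_mono2) auto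
  also have "\<dots> = 2 powr \<alpha> * t powr \<alpha>" using assms by (simp add: powr_mult)
  also have "\<dots> \<le> 2 * t powr \<alpha>"
    using assms powr_mono[of \<alpha> 1 2] by (intro mult_right_mono) auto
  finally show ?thesis using assms by (simp add: field_simps)
qed

lemma abs_ln_diff_le_lower:
  fixes p q m :: real
  assumes "m > 0" "p \<ge> m" "q \<ge> m"
  shows "\<bar>ln p - ln q\<bar> \<le> \<bar>p - q\<bar> / m"
proof -
  have *: "ln p - ln q \<le> \<bar>p - q\<bar> / m" if "p \<ge> m" "q \<ge> m" for p q
  proof -
    have "ln p - ln q = ln (p / q)" using that assms(1) by (simp add: ln_div)
    also have "\<dots> \<le> p / q - 1" using that assms(1) by (intro ln_le_minus_one) auto
    also have "\<dots> = (p - q) / q" using that assms(1) by (simp add: field_simps)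
    also have "\<dots> \<le> \<bar>p - q\<bar> / q" using that assms(1) by (intro divide_right_mono) auto
    also have "\<dots> \<le> \<bar>p - q\<bar> / m" using that assms(1) by (intro divide_left_mono mult_pos_pos) auto
    finally show ?thesis .
  qed
  show ?thesis using *[of p q] *[of q p] assms by (simp add: abs_le_iff abs_minus_commute)
qed

text \<open>If v is the smaller number, then u / v \<le> 1 + d / v, and only the power of v is
  needed. Adding both powers makes the bound symmetric.\<close>

lemma abs_ln_diff_le_powr:
  fixes u v d \<alpha> :: real
  assumes "0 < \<alpha>" "\<alpha> \<le> 1" "u > 0" "v > 0" "\<bar>u - v\<bar> \<le> d"
  shows "\<bar>ln u - ln v\<bar> \<le> 2 / \<alpha> * d powr \<alpha> * (u powr -\<alpha> + v powr -\<alpha>)"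
proof -
  have *: "ln u - ln v \<le> 2 / \<alpha> * d powr \<alpha> * v powr -\<alpha>" if "u > 0" "v > 0" "\<bar>u - v\<bar> \<le> d" for u v
  proof -
    have "ln u - ln v = ln (u / v)" using that by (simp add: ln_div)
    also have "\<dots> \<le> ln (1 + d / v)"
      using that by (subst ln_le_cancel_iff) (auto simp: field_simps)
    also have "\<dots> \<le> 2 / \<alpha> * (d / v) powr \<alpha>"
      using that assms by (intro ln_add_one_le_powr) auto
    also have "\<dots> = 2 / \<alpha> * d powr \<alpha> * v powr -\<alpha>"
      using that by (simp add: powr_divide powr_minus field_simps)
    finally show ?thesis .
  qed
  have "2 / \<alpha> * d powr \<alpha> * u powr -\<alpha> \<ge> 0" "2 / \<alpha> * d powr \<alpha> * v powr -\<alpha> \<ge> 0"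
    using assms by simp_all
  moreover have "ln u - ln v \<le> 2 / \<alpha> * d powr \<alpha> * v powr -\<alpha>"
    "ln v - ln u \<le> 2 / \<alpha> * d powr \<alpha> * u powr -\<alpha>"
    using *[of u v] *[of v u] assms by (auto simp: abs_minus_commute)
  ultimately show ?thesis unfolding distrib_left by linarith
qed

text \<open>The numerator may be close to 0 and takes the power bound. The denominator stays above
  R^2 / 4 on the disc of radius 3 R / 4, so its logarithm is Lipschitz and gives the term 4 d /
  R.\<close>

lemma ln_blaschke_diff:
  fixes R \<alpha> :: real
  assumes \<alpha>: "0 < \<alpha>" "\<alpha> \<le> 1" and R: "R > 0" and a: "norm a < R"
    and xy: "norm x \<le> 3 / 4 * R" "norm y \<le> 3 / 4 * R" "x \<noteq> a" "y \<noteq> a" and d: "norm (y - x) \<le> d"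
  shows "\<bar>ln (norm (blaschke R a y)) - ln (norm (blaschke R a x))\<bar>
    \<le> 4 * d / R + 2 / \<alpha> * d powr \<alpha> * (norm (x - a) powr -\<alpha> + norm (y - a) powr -\<alpha>)"
proof -
  define D where "D z = of_real (R\<^sup>2) - cnj a * z" for z
  have Dge: "norm (D z) \<ge> R\<^sup>2 / 4" if "norm z \<le> 3 / 4 * R" for z
  proof -
    have "norm (cnj a * z) \<le> R * (3 / 4 * R)"
      unfolding norm_mult using a that R by (intro mult_mono) auto
    moreover have "R\<^sup>2 - norm (cnj a * z) \<le> norm (D z)"
      using norm_triangle_ineq2[of "of_real (R\<^sup>2)" "cnj a * z"] by (simp add: D_def norm_power)
    ultimately show ?thesis by (simp add: power2_eq_square)
  qed
  have R4: "R\<^sup>2 / 4 > 0" using R by simp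
  have ln: "ln (norm (blaschke R a z)) = ln R + ln (norm (z - a)) - ln (norm (D z))"
    if "norm z \<le> 3 / 4 * R" "z \<noteq> a" for z
  proof -
    have "norm (D z) > 0" using Dge[OF that(1)] R4 by linarith
    thus ?thesis using that R by (simp add: blaschke_def D_def norm_mult norm_divide ln_mult ln_div)
  qed
  have "\<bar>ln (norm (D x)) - ln (norm (D y))\<bar> \<le> \<bar>norm (D x) - norm (D y)\<bar> / (R\<^sup>2 / 4)"
    using R4 Dge xy by (intro abs_ln_diff_le_lower) auto
  also have "\<dots> \<le> (R * d) / (R\<^sup>2 / 4)"
  proof (intro divide_right_mono)
    have "\<bar>norm (D x) - norm (D y)\<bar> \<le> norm (D x - D y)" by (rule norm_triangle_ineq3)
    also have "D x - D y = cnj a * (y - x)" by (simp add: D_def algebra_simps)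
    also have "norm \<dots> \<le> R * d"
      unfolding norm_mult using a R d by (intro mult_mono) auto
    finally show "\<bar>norm (D x) - norm (D y)\<bar> \<le> R * d" .
  qed auto
  also have "\<dots> = 4 * d / R" using R by (simp add: power2_eq_square)
  finally have 1: "\<bar>ln (norm (D x)) - ln (norm (D y))\<bar> \<le> 4 * d / R" .
  have "\<bar>norm (x - a) - norm (y - a)\<bar> \<le> d"
    using norm_triangle_ineq3[of "x - a" "y - a"] d by (simp add: norm_minus_commute)
  hence "\<bar>ln (norm (x - a)) - ln (norm (y - a))\<bar> \<le> 2 / \<alpha> * d powr \<alpha> * (norm (x - a) powr -\<alpha> + norm (y - a) powr -\<alpha>)"
    using \<alpha> xy by (intro abs_ln_diff_le_powr) auto
  with 1 show ?thesis unfolding ln[OF xy(1,3)] ln[OF xy(2,4)] by linarith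
qed

lemma proximity_nonneg: "proximity r g \<ge> 0"
proof -
  have "integral {0..2 * pi} (\<lambda>\<theta>. ln_plus (norm (g (of_real r * cis \<theta>)))) \<ge> 0"
    by (cases "(\<lambda>\<theta>. ln_plus (norm (g (of_real r * cis \<theta>)))) integrable_on {0..2 * pi}")
       (auto intro!: integral_nonneg simp: not_integrable_integral ln_plus_def)
  thus ?thesis by (simp add: proximity_def)
qed

text \<open>In the application p and q are the moduli of f at the two shifted points, v is its
  modulus at x, and s = \<bar>z\<bar>. Since p + q \<le> 2 max(p, q) and s \<ge> 1, the quotient is
  at most max(p, q) / v.\<close>

lemma ln_plus_mean_le:
  fixes p q s u v :: real
  assumes "p > 0" "q > 0" "v > 0" "s \<ge> 1" "u \<le> (p + q) / (2 * s * v)"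
  shows "ln_plus u \<le> \<bar>ln p - ln v\<bar> + \<bar>ln q - ln v\<bar>"
proof -
  define m where "m = max p q"
  have "(p + q) / (2 * s * v) \<le> 2 * m / (2 * 1 * v)"
    using assms by (intro frac_le mult_mono add_pos_pos) (auto simp: m_def)
  hence "u \<le> m / v" using assms by simp
  hence "ln_plus u \<le> max 0 (ln (m / v))"
    by (cases "u \<le> 1") (auto simp: ln_plus_def)
  moreover have "ln (m / v) \<le> \<bar>ln p - ln v\<bar> + \<bar>ln q - ln v\<bar>"
    using assms by (auto simp: m_def max_def ln_div)
  ultimately show ?thesis by auto
qed

context nonzero_meromorphic
begin

text \<open>By the factorization, ln \<bar>f\<bar> is the sum of the orders times the logarithms of
  the Blaschke moduli, plus Re h. The two parts are estimated separately. On the circle the first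
  part vanishes, which identifies the mean of \<bar>Re h\<bar> with
  \<open>log_mean R\<close>.\<close>

lemma ln_ratio_bound:
  fixes R \<alpha> :: real
  assumes \<alpha>: "0 < \<alpha>" "\<alpha> \<le> 1" and R: "R > 0" and circ: "\<And>z. norm z = R \<Longrightarrow> f z \<noteq> 0"
    and xy: "norm x \<le> 3 / 4 * R" "norm y \<le> 3 / 4 * R" "f x \<noteq> 0" "f y \<noteq> 0" and d: "norm (y - x) \<le> d"
  shows "\<bar>ln (norm (f y)) - ln (norm (f x))\<bar> \<le>
     (\<Sum>a\<in>zeros_poles R. \<bar>real_of_int (zorder f a)\<bar> * (4 * d / R + 2 / \<alpha> * d powr \<alpha> * (norm (x - a) powr -\<alpha> + norm (y - a) powr -\<alpha>)))
     + 32 * d / R * log_mean R"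
proof -
  obtain R' h where h: "R' > R" "h holomorphic_on ball 0 R'"
    "\<And>z. norm z \<le> R \<Longrightarrow> f z \<noteq> 0 \<Longrightarrow> f z = (\<Prod>a\<in>zeros_poles R. blaschke R a z powi zorder f a) * exp (h z)"
    using blaschke_factorization[OF nicely nonzero R circ] unfolding zeros_poles_def by blast
  have za: "z \<noteq> a" if "f z \<noteq> 0" "a \<in> zeros_poles R" for z a using that by (auto simp: zeros_poles_def)
  have lnf: "ln (norm (f z)) = (\<Sum>a\<in>zeros_poles R. of_int (zorder f a) * ln (norm (blaschke R a z))) + Re (h z)"
    if z: "norm z \<le> R" "f z \<noteq> 0" for z
  proof -
    have pos: "norm (blaschke R a z) > 0" if "a \<in> zeros_poles R" for a
      using blaschke_eq_0_iff[of a R z] za[OF z(2) that] that z by (auto simp: zeros_poles_def)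
    have nz: "norm (blaschke R a z) powi zorder f a \<noteq> 0" if "a \<in> zeros_poles R" for a
      using pos[OF that] by simp
    have "norm (f z) = (\<Prod>a\<in>zeros_poles R. norm (blaschke R a z) powi zorder f a) * exp (Re (h z))"
      by (subst h(3)[OF z]) (simp add: norm_mult prod_norm[symmetric] norm_power_int)
    also have "ln \<dots> = (\<Sum>a\<in>zeros_poles R. ln (norm (blaschke R a z) powi zorder f a)) + Re (h z)"
      using nz finite_zeros_poles by (simp add: ln_mult ln_prod)
    also have "(\<Sum>a\<in>zeros_poles R. ln (norm (blaschke R a z) powi zorder f a))
        = (\<Sum>a\<in>zeros_poles R. of_int (zorder f a) * ln (norm (blaschke R a z)))"
    proof (intro sum.cong refl)
      fix a assume "a \<in> zeros_poles R"
      thus "ln (norm (blaschke R a z) powi zorder f a) = of_int (zorder f a) * ln (norm (blaschke R a z))"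
        using pos[of a] by (simp add: powr_real_of_int' [symmetric] ln_powr)
    qed
    finally show ?thesis .
  qed
  have lm: "integral {0..2 * pi} (\<lambda>t. \<bar>Re (h (of_real R * cis t))\<bar>) = 2 * pi * log_mean R"
  proof -
    have "Re (h (of_real R * cis t)) = ln (norm (f (of_real R * cis t)))" for t
    proof -
      have z: "norm (of_real R * cis t) = R" using R by (simp add: norm_mult)
      have "(\<Sum>a\<in>zeros_poles R. of_int (zorder f a) * ln (norm (blaschke R a (of_real R * cis t)))) = 0"
        using z by (intro sum.neutral) (auto simp: norm_blaschke_circle zeros_poles_def)
      thus ?thesis using lnf[of "of_real R * cis t"] circ[OF z] z by simp
    qed
    thus ?thesis by (simp add: log_mean_def)
  qed
  have "norm (h y - h x) \<le> 32 / R * log_mean R * norm (y - x)"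
  proof (rule field_differentiable_bound[of "cball 0 (3 / 4 * R)"])
    fix w :: complex assume w: "w \<in> cball 0 (3 / 4 * R)"
    have "w \<in> ball 0 R'" using w h(1) R by auto
    hence "(h has_field_derivative deriv h w) (at w)"
      using h(2) by (intro holomorphic_derivI) auto
    thus "(h has_field_derivative deriv h w) (at w within cball 0 (3 / 4 * R))"
      by (rule has_field_derivative_at_within)
    have "norm w < R" using w R by auto
    from norm_deriv_le_Re_mean[OF h(2) R h(1) this]
    have "norm (deriv h w) \<le> R / (pi * (R - norm w)\<^sup>2) * (2 * pi * log_mean R)"
      unfolding lm .
    \<comment> \<open>On this disc R - \<bar>w\<bar> \<ge> R / 4, so the constant is 2 * 16 =
      32.\<close>
    also have "\<dots> \<le> R / (pi * (R / 4)\<^sup>2) * (2 * pi * log_mean R)"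
    proof (intro mult_right_mono divide_left_mono mult_left_mono power_mono mult_pos_pos)
      show "R / 4 \<le> R - norm w" using w by simp
    qed (use R \<open>norm w < R\<close> log_mean_nonneg[of R] in auto)
    also have "\<dots> = 32 / R * log_mean R" using R by (simp add: power2_eq_square field_simps)
    finally show "norm (deriv h w) \<le> 32 / R * log_mean R" .
  qed (use xy in auto)
  also have "\<dots> \<le> 32 / R * log_mean R * d"
    using d R log_mean_nonneg by (intro mult_left_mono) auto
  finally have hd: "\<bar>Re (h y) - Re (h x)\<bar> \<le> 32 * d / R * log_mean R"
    using abs_Re_le_cmod[of "h y - h x"] by (simp add: mult_ac)
  define b where "b a = ln (norm (blaschke R a y)) - ln (norm (blaschke R a x))" for a
  have "ln (norm (f y)) - ln (norm (f x)) = (\<Sum>a\<in>zeros_poles R. of_int (zorder f a) * b a) + (Re (h y) - Re (h x))"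
    using lnf[of x] lnf[of y] xy R by (simp add: b_def sum_subtractf right_diff_distrib)
  also have "\<bar>\<dots>\<bar> \<le> \<bar>\<Sum>a\<in>zeros_poles R. of_int (zorder f a) * b a\<bar> + \<bar>Re (h y) - Re (h x)\<bar>"
    by (rule abs_triangle_ineq)
  also have "\<bar>\<Sum>a\<in>zeros_poles R. of_int (zorder f a) * b a\<bar> \<le> (\<Sum>a\<in>zeros_poles R. \<bar>real_of_int (zorder f a)\<bar> * \<bar>b a\<bar>)"
    using sum_abs[of "\<lambda>a. of_int (zorder f a) * b a" "zeros_poles R"] by (simp add: abs_mult)
  also have "\<dots> \<le> (\<Sum>a\<in>zeros_poles R. \<bar>real_of_int (zorder f a)\<bar> * (4 * d / R + 2 / \<alpha> * d powr \<alpha> * (norm (x - a) powr -\<alpha> + norm (y - a) powr -\<alpha>)))"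
    unfolding b_def using \<alpha> R xy d za
    by (intro sum_mono mult_left_mono ln_blaschke_diff) (auto simp: zeros_poles_def)
  finally show ?thesis using hd by linarith
qed

end

section \<open>The proximity function of the Wilson quotient\<close>

context nonzero_meromorphic
begin

text \<open>This integrates \<open>ln_ratio_bound\<close> with d = 2 sqrt r over the circle, once
  for each shift. For a zero or pole, d to the power \<alpha> times the mean of order r to the power
  -\<alpha> leaves r to the power -\<alpha> / 2.\<close>

lemma wilson_proximity_le:
  fixes r R \<alpha> :: real
  assumes \<alpha>: "0 < \<alpha>" "\<alpha> < 1" and r: "r \<ge> 16" and R: "R \<ge> 2 * r"
    and circ: "\<And>z. norm z = R \<Longrightarrow> f z \<noteq> 0"
  defines "C \<equiv> 2 * 2 powr \<alpha> * (24 powr \<alpha> * (2 * (3 * pi) powr (1 - \<alpha>) / (1 - \<alpha>)))"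
  shows "proximity r (\<lambda>x. wilson_op f x / f x)
    \<le> (144 * pi + 16 * C / \<alpha>) * ((\<Sum>a\<in>zeros_poles R. \<bar>real_of_int (zorder f a)\<bar>) + log_mean R) * r powr (- \<alpha> / 2)"
proof -
  define s where "s = sqrt r"
  have s: "s \<ge> 4" "s\<^sup>2 = r"
    using r real_le_rsqrt[of 4 r] by (auto simp: s_def)
  have R0: "R > 0" using r R by simp
  define m where "m a = \<bar>real_of_int (zorder f a)\<bar>" for a
  define N where "N = (\<Sum>a\<in>zeros_poles R. m a)"
  define J where "J = log_mean R"
  have J0: "J \<ge> 0" and N0: "N \<ge> 0" and C0: "C \<ge> 0"
    using log_mean_nonneg \<alpha> by (auto simp: J_def N_def m_def C_def intro!: sum_nonneg)
  define E where "E = 2 / \<alpha> * (2 * s) powr \<alpha>"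
  have E0: "E \<ge> 0" using \<alpha> by (simp add: E_def)
  define w where "w \<delta> \<theta> = (of_real s * cis (\<theta> / 2) + \<delta>)\<^sup>2" for \<delta> \<theta>
  define v where "v \<delta> a \<theta> = norm (w \<delta> \<theta> - a) powr -\<alpha>" for \<delta> a \<theta>
  \<comment> \<open>This is the right side of \<open>ln_ratio_bound\<close> for the points
    \<open>w 0 \<theta>\<close> and \<open>w \<delta> \<theta>\<close> with d = 2 s.\<close>
  define G where "G \<delta> = (\<lambda>\<theta>. (\<Sum>a\<in>zeros_poles R. m a * (4 * (2 * s) / R + E * (v 0 a \<theta> + v \<delta> a \<theta>))) + 32 * (2 * s) / R * J)" for \<delta>
  have vi: "v \<delta> a integrable_on {0..2 * pi}" "integral {0..2 * pi} (v \<delta> a) \<le> C * r powr -\<alpha>"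
    if "norm \<delta> \<le> 1 / 2" for \<delta> a
  proof -
    have "s powr (-2 * \<alpha>) = (s powr 2) powr -\<alpha>" by (simp add: powr_powr)
    also have "s powr 2 = r" using s by simp
    finally have "s powr (-2 * \<alpha>) = r powr -\<alpha>" .
    thus "v \<delta> a integrable_on {0..2 * pi}" "integral {0..2 * pi} (v \<delta> a) \<le> C * r powr -\<alpha>"
      using integral_shifted_square_powr[OF \<alpha>, of s \<delta> a] s that by (simp_all add: v_def[abs_def] w_def C_def)
  qed
  define K where "K = N * (8 * pi + 8 * C / \<alpha>) * r powr (- \<alpha> / 2) + 64 * pi * J * r powr (- \<alpha> / 2)"
  have G: "(G \<delta> has_integral integral {0..2 * pi} (G \<delta>)) {0..2 * pi}" "integral {0..2 * pi} (G \<delta>) \<le> K"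
    if \<delta>: "norm \<delta> \<le> 1 / 2" for \<delta>
  proof -
    have vh: "(v \<delta>' a has_integral integral {0..2 * pi} (v \<delta>' a)) {0..2 * pi}" if "norm \<delta>' \<le> 1 / 2" for \<delta>' a
      using vi(1)[OF that] by (rule integrable_integral)
    have ch: "((\<lambda>_. c) has_integral 2 * pi * c) {0..2 * pi}" for c :: real
      using has_integral_const_real[of c 0 "2 * pi"] by simp
    have GI: "(G \<delta> has_integral (\<Sum>a\<in>zeros_poles R. m a * (2 * pi * (4 * (2 * s) / R) +
        E * (integral {0..2 * pi} (v 0 a) + integral {0..2 * pi} (v \<delta> a)))) + 2 * pi * (32 * (2 * s) / R * J)) {0..2 * pi}"
      unfolding G_def using \<delta>
      by (intro has_integral_add has_integral_sum has_integral_mult_right finite_zeros_poles vh ch) auto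
    show "(G \<delta> has_integral integral {0..2 * pi} (G \<delta>)) {0..2 * pi}"
      using GI by (simp add: has_integral_integrable_integral)
    \<comment> \<open>Since \<alpha> < 1, the decay 1 / s of the Lipschitz and Schwarz terms is at
      least as good as that of the singular terms, so one power of r serves for all.\<close>
    have rs: "r powr (- \<alpha> / 2) * s \<ge> 1"
    proof -
      have "s = r powr (1 / 2)" using r by (simp add: s_def powr_half_sqrt)
      hence "r powr (- \<alpha> / 2) * s = r powr ((1 - \<alpha>) / 2)"
        by (simp add: diff_divide_distrib flip: powr_add)
      thus ?thesis using r \<alpha> by (simp add: ge_one_powr_ge_zero)
    qed
    have sR: "s / R \<le> r powr (- \<alpha> / 2) / 2"
    proof -
      have "s / R \<le> s / (2 * r)" using R r s by (intro divide_left_mono) auto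
      also have "\<dots> = 1 / s / 2" using s by (simp add: power2_eq_square flip: s(2))
      also have "1 / s \<le> r powr (- \<alpha> / 2)" using rs s by (simp add: field_simps)
      finally show ?thesis by simp
    qed
    have EC: "E * r powr -\<alpha> \<le> 4 / \<alpha> * r powr (- \<alpha> / 2)"
    proof -
      have "E * r powr -\<alpha> = 2 / \<alpha> * 2 powr \<alpha> * (s powr \<alpha> * r powr -\<alpha>)"
        using s by (simp add: E_def powr_mult)
      also have "s powr \<alpha> = r powr (\<alpha> / 2)"
        using r by (simp add: s_def powr_half_sqrt[symmetric] powr_powr)
      also have "r powr (\<alpha> / 2) * r powr -\<alpha> = r powr (- \<alpha> / 2)"
        by (simp flip: powr_add)
      also have "2 / \<alpha> * 2 powr \<alpha> * r powr (- \<alpha> / 2) \<le> 2 / \<alpha> * 2 * r powr (- \<alpha> / 2)"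
        using \<alpha> powr_mono[of \<alpha> 1 2] by (intro mult_right_mono mult_left_mono) auto
      finally show ?thesis by simp
    qed
    have "integral {0..2 * pi} (G \<delta>) = (\<Sum>a\<in>zeros_poles R. m a * (2 * pi * (4 * (2 * s) / R) +
        E * (integral {0..2 * pi} (v 0 a) + integral {0..2 * pi} (v \<delta> a)))) + 2 * pi * (32 * (2 * s) / R * J)"
      using GI by (rule integral_unique)
    also have "\<dots> \<le> (\<Sum>a\<in>zeros_poles R. m a * ((8 * pi + 8 * C / \<alpha>) * r powr (- \<alpha> / 2))) + 64 * pi * J * r powr (- \<alpha> / 2)"
    proof (intro add_mono sum_mono mult_left_mono)
      fix a
      have "E * (integral {0..2 * pi} (v 0 a) + integral {0..2 * pi} (v \<delta> a)) \<le> E * (C * r powr -\<alpha> + C * r powr -\<alpha>)"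
        using vi(2)[of 0 a] vi(2)[OF \<delta>, of a] E0 by (intro mult_left_mono add_mono) auto
      also have "\<dots> = 2 * C * (E * r powr -\<alpha>)" by simp
      also have "\<dots> \<le> 2 * C * (4 / \<alpha> * r powr (- \<alpha> / 2))"
        using EC C0 by (intro mult_left_mono) auto
      also have "\<dots> = 8 * C / \<alpha> * r powr (- \<alpha> / 2)" by simp
      moreover have "2 * pi * (4 * (2 * s) / R) = 16 * pi * (s / R)" by simp
      moreover have "16 * pi * (s / R) \<le> 16 * pi * (r powr (- \<alpha> / 2) / 2)"
        using sR by (intro mult_left_mono) auto
      ultimately show "2 * pi * (4 * (2 * s) / R) + E * (integral {0..2 * pi} (v 0 a) + integral {0..2 * pi} (v \<delta> a))
          \<le> (8 * pi + 8 * C / \<alpha>) * r powr (- \<alpha> / 2)"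
        by (simp add: distrib_right)
    next
      have "2 * pi * (32 * (2 * s) / R * J) = 128 * pi * J * (s / R)" by simp
      also have "\<dots> \<le> 128 * pi * J * (r powr (- \<alpha> / 2) / 2)"
        using sR J0 by (intro mult_left_mono) auto
      also have "\<dots> = 64 * pi * J * r powr (- \<alpha> / 2)" by simp
      finally show "2 * pi * (32 * (2 * s) / R * J) \<le> 64 * pi * J * r powr (- \<alpha> / 2)" .
    qed (auto simp: m_def)
    also have "\<dots> = K" by (simp add: K_def N_def sum_distrib_right sum_distrib_left mult_ac)
    finally show "integral {0..2 * pi} (G \<delta>) \<le> K" .
  qed

  \<comment> \<open>These are the z for which some (z + \<delta>)^2 is a zero or pole of f in the
    disc. They exclude only finitely many angles, so setting the integrand to 0 there, as in
    \<open>F'\<close>, leaves the integral unchanged.\<close>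
  define Z where "Z = (\<Union>\<delta>\<in>{0, \<i> / 2, - \<i> / 2}. \<Union>a\<in>zeros_poles R. {csqrt a - \<delta>, - csqrt a - \<delta>})"
  define X where "X = {\<theta>\<in>{0..2 * pi}. of_real s * cis (\<theta> / 2) \<in> Z}"
  have finX: "finite X"
  proof -
    have "finite Z" unfolding Z_def using finite_zeros_poles by auto
    \<comment> \<open>The half angles lie in [0, pi], where the cosine is injective.\<close>
    moreover have "inj_on (\<lambda>\<theta>. of_real s * cis (\<theta> / 2)) {0..2 * pi}"
    proof (rule inj_onI)
      fix x y assume xy: "x \<in> {0..2 * pi}" "y \<in> {0..2 * pi}" "of_real s * cis (x / 2) = of_real s * cis (y / 2)"
      hence "cos (x / 2) = cos (y / 2)" using s by (simp add: complex_eq_iff)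
      with xy have "x / 2 = y / 2" by (subst cos_inj_pi[of "x / 2" "y / 2"]) auto
      thus "x = y" by simp
    qed
    ultimately have "finite ((\<lambda>\<theta>. of_real s * cis (\<theta> / 2)) -` Z \<inter> {0..2 * pi})"
      by (intro finite_vimage_IntI)
    thus ?thesis by (rule finite_subset[rotated]) (auto simp: X_def)
  qed
  define F where "F \<theta> = ln_plus (norm (wilson_op f (of_real r * cis \<theta>) / f (of_real r * cis \<theta>)))" for \<theta>
  define F' where "F' \<theta> = (if \<theta> \<in> X then 0 else F \<theta>)" for \<theta>
  have le: "F' \<theta> \<le> G (\<i> / 2) \<theta> + G (- \<i> / 2) \<theta>" if \<theta>: "\<theta> \<in> {0..2 * pi}" for \<theta>
  proof (cases "\<theta> \<in> X")
    case True
    have "G \<delta> \<theta> \<ge> 0" for \<delta>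
      unfolding G_def using E0 J0 s R0
      by (intro add_nonneg_nonneg sum_nonneg mult_nonneg_nonneg) (auto simp: m_def v_def)
    thus ?thesis using True by (simp add: F'_def)
  next
    case False
    define z where "z = of_real s * cis (\<theta> / 2)"
    have nz: "norm z = s" using s by (simp add: z_def norm_mult)
    have wz: "w \<delta> \<theta> = (z + \<delta>)\<^sup>2" for \<delta> by (simp add: w_def z_def)
    have z2: "z\<^sup>2 = of_real r * cis \<theta>"
      using s(2) by (simp add: z_def power_mult_distrib Complex.DeMoivre flip: of_real_power)
    have xn: "norm (w 0 \<theta>) = r" using nz s by (simp add: wz norm_power)
    have diff: "norm (w \<delta> \<theta> - w 0 \<theta>) \<le> 2 * s" if "norm \<delta> \<le> 1 / 2" for \<delta>
    proof -
      have "w \<delta> \<theta> - w 0 \<theta> = 2 * z * \<delta> + \<delta>\<^sup>2" by (simp add: wz power2_eq_square algebra_simps)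
      hence "norm (w \<delta> \<theta> - w 0 \<theta>) \<le> 2 * s * norm \<delta> + (norm \<delta>)\<^sup>2"
        using norm_triangle_ineq[of "2 * z * \<delta>" "\<delta>\<^sup>2"] by (simp add: norm_mult norm_power nz)
      also have "\<dots> \<le> 2 * s * (1 / 2) + (1 / 2)\<^sup>2"
        using that s by (intro add_mono mult_left_mono power_mono) auto
      finally show ?thesis using s by (simp add: power2_eq_square)
    qed
    \<comment> \<open>This is where r \<ge> 16 enters: the shifted points have modulus at most 3 r /
      2 \<le> 3 R / 4.\<close>
    have rs: "2 * s \<le> r / 2" using s mult_right_mono[of 4 s s] by (simp add: power2_eq_square flip: s(2))
    have wn: "norm (w \<delta> \<theta>) \<le> 3 / 4 * R" if "norm \<delta> \<le> 1 / 2" for \<delta>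
      using diff[OF that] norm_triangle_ineq2[of "w \<delta> \<theta>" "w 0 \<theta>"] xn rs R by linarith
    have fw: "f (w \<delta> \<theta>) \<noteq> 0" if "\<delta> \<in> {0, \<i> / 2, - \<i> / 2}" for \<delta>
    proof
      assume "f (w \<delta> \<theta>) = 0"
      moreover have "norm \<delta> \<le> 1 / 2" using that by (elim insertE emptyE; hypsubst) simp_all
      ultimately have "w \<delta> \<theta> \<in> zeros_poles R" using wn[of \<delta>] R0 by (auto simp: zeros_poles_def)
      moreover have "(z + \<delta>)\<^sup>2 = (csqrt (w \<delta> \<theta>))\<^sup>2" by (simp add: wz)
      hence "z + \<delta> = csqrt (w \<delta> \<theta>) \<or> z + \<delta> = - csqrt (w \<delta> \<theta>)" by (simp only: power2_eq_iff)
      hence "z = csqrt (w \<delta> \<theta>) - \<delta> \<or> z = - csqrt (w \<delta> \<theta>) - \<delta>" by (auto simp: algebra_simps)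
      ultimately have "z \<in> Z" unfolding Z_def using that by blast
      thus False using False \<theta> by (simp add: X_def z_def)
    qed
    have Gge: "\<bar>ln (norm (f (w \<delta> \<theta>))) - ln (norm (f (w 0 \<theta>)))\<bar> \<le> G \<delta> \<theta>"
      if "\<delta> \<in> {\<i> / 2, - \<i> / 2}" for \<delta>
    proof -
      have "norm \<delta> \<le> 1 / 2" using that by (elim insertE emptyE; hypsubst) simp_all
      from ln_ratio_bound[OF \<alpha>(1) _ R0 circ wn[of 0] wn[OF this] fw[of 0] fw[of \<delta>] diff[OF this]] that \<alpha>
      show ?thesis by (simp add: G_def E_def J_def m_def v_def mult_ac)
    qed
    have "z \<noteq> 0" using nz s by auto
    \<comment> \<open>For \<theta> > pi this z is the negative of the principal root;
      \<open>wilson_op_eq\<close> admits either root.\<close>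
    hence "wilson_op f (w 0 \<theta>) = wilson_quotient f z"
      by (intro wilson_op_eq) (auto simp: wz)
    also have "\<dots> = (f (w (\<i> / 2) \<theta>) - f (w (- \<i> / 2) \<theta>)) / (2 * \<i> * z)"
      by (simp add: wilson_quotient_def wz)
    also have "norm (\<dots> / f (w 0 \<theta>)) = norm (f (w (\<i> / 2) \<theta>) - f (w (- \<i> / 2) \<theta>)) / (2 * s * norm (f (w 0 \<theta>)))"
      by (simp add: norm_mult norm_divide nz)
    also have "\<dots> \<le> (norm (f (w (\<i> / 2) \<theta>)) + norm (f (w (- \<i> / 2) \<theta>))) / (2 * s * norm (f (w 0 \<theta>)))"
      using s by (intro divide_right_mono norm_triangle_ineq4) auto
    finally have "ln_plus (norm (wilson_op f (w 0 \<theta>) / f (w 0 \<theta>)))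
      \<le> \<bar>ln (norm (f (w (\<i> / 2) \<theta>))) - ln (norm (f (w 0 \<theta>)))\<bar> + \<bar>ln (norm (f (w (- \<i> / 2) \<theta>))) - ln (norm (f (w 0 \<theta>)))\<bar>"
      using fw s by (intro ln_plus_mean_le[where s = s]) auto
    also have "\<dots> \<le> G (\<i> / 2) \<theta> + G (- \<i> / 2) \<theta>" by (intro add_mono Gge) auto
    finally show ?thesis using False by (simp add: F'_def F_def wz z2)
  qed
  have "integral {0..2 * pi} F \<le> 2 * K"
  \<comment> \<open>A nonexistent integral is 0 by convention, so in that case the bound is just K
    \<ge> 0.\<close>
  proof (cases "F integrable_on {0..2 * pi}")
    case True
    have F'i: "F' integrable_on {0..2 * pi}"
      by (rule integrable_spike_finite[OF finX _ True]) (auto simp: F'_def)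
    have "integral {0..2 * pi} F = integral {0..2 * pi} F'"
      by (rule integral_spike[of X]) (auto simp: F'_def finX negligible_finite)
    also have "\<dots> \<le> integral {0..2 * pi} (\<lambda>\<theta>. G (\<i> / 2) \<theta> + G (- \<i> / 2) \<theta>)"
      using le F'i has_integral_integrable[OF G(1)] by (intro integral_le integrable_add) auto
    also have "\<dots> = integral {0..2 * pi} (G (\<i> / 2)) + integral {0..2 * pi} (G (- \<i> / 2))"
      using has_integral_integrable[OF G(1)] by (intro integral_add) auto
    also have "\<dots> \<le> 2 * K" using G(2)[of "\<i> / 2"] G(2)[of "- \<i> / 2"] by simp
    finally show ?thesis .
  next
    case False
    have "K \<ge> 0" using N0 J0 C0 \<alpha> by (simp add: K_def)
    thus ?thesis using False by (simp add: not_integrable_integral)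
  qed
  moreover have "proximity r (\<lambda>x. wilson_op f x / f x) = integral {0..2 * pi} F / (2 * pi)"
    by (simp add: proximity_def F_def[abs_def])
  moreover have K0: "K \<ge> 0" using N0 J0 C0 \<alpha> by (simp add: K_def)
  ultimately have "proximity r (\<lambda>x. wilson_op f x / f x) \<le> 2 * K / (2 * pi)"
    by (simp only:) (intro divide_right_mono, auto)
  also have "\<dots> \<le> 2 * K / 1"
    using K0 pi_gt3 by (intro divide_left_mono) auto
  also have "\<dots> = ((16 * pi + 16 * C / \<alpha>) * N + 128 * pi * J) * r powr (- \<alpha> / 2)"
    by (simp add: K_def algebra_simps add_divide_distrib)
  \<comment> \<open>The constant 144 = 16 + 128 dominates the coefficients of both N and J.\<close>
  also have "\<dots> \<le> ((144 * pi + 16 * C / \<alpha>) * N + (144 * pi + 16 * C / \<alpha>) * J) * r powr (- \<alpha> / 2)"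
    using N0 J0 C0 \<alpha> by (intro mult_right_mono add_mono) auto
  finally show ?thesis by (simp add: N_def m_def J_def distrib_left)
qed

lemma exists_zero_free_circle:
  assumes "a < b"
  obtains R where "a < R" "R < b" "\<And>z. norm z = R \<Longrightarrow> f z \<noteq> 0"
proof -
  have "finite (norm ` zeros_poles b)" using finite_zeros_poles by simp
  moreover have "infinite {a<..<b}" using assms by simp
  ultimately obtain R where "R \<in> {a<..<b}" "R \<notin> norm ` zeros_poles b"
    by (meson finite_subset subsetI)
  thus ?thesis using that[of R] by (force simp: zeros_poles_def)
qed

end

section \<open>Growth of the characteristic and the final estimate\<close>

lemma mero_order_nonneg:
  assumes "mero_order f = ereal \<sigma>"
  shows "\<sigma> \<ge> 0"
proof -
  have "eventually (\<lambda>r. 0 \<le> ereal (ln_plus (nevanlinna_char r f) / ln r)) at_top"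
    using eventually_ge_at_top[of 1] by eventually_elim (auto simp: ln_plus_def)
  hence "0 \<le> Limsup at_top (\<lambda>r. ereal (ln_plus (nevanlinna_char r f) / ln r))"
    by (intro le_Limsup) auto
  thus ?thesis using assms by (simp add: mero_order_def)
qed

lemma mero_order_char_le:
  assumes "mero_order f = ereal \<sigma>" "\<sigma> < \<tau>"
  shows "eventually (\<lambda>r. nevanlinna_char r f \<le> r powr \<tau>) at_top"
proof -
  have "eventually (\<lambda>r. ereal (ln_plus (nevanlinna_char r f) / ln r) < ereal \<tau>) at_top"
    using assms by (intro Limsup_lessD) (simp add: mero_order_def)
  thus ?thesis using eventually_gt_at_top[of 1]
  proof eventually_elim
    case (elim r)
    show ?case
    proof (cases "nevanlinna_char r f \<le> 0")
      case False
      have "ln (nevanlinna_char r f) \<le> ln_plus (nevanlinna_char r f)"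
        using False by (simp add: ln_plus_def)
      also have "\<dots> \<le> \<tau> * ln r" using elim by (simp add: field_simps)
      also have "\<dots> = ln (r powr \<tau>)" using elim by (simp add: ln_powr)
      finally have "ln (nevanlinna_char r f) \<le> ln (r powr \<tau>)" .
      thus ?thesis using False elim by (subst (asm) ln_le_cancel_iff) auto
    qed (use powr_ge_zero[of r \<tau>] in linarith)
  qed
qed

theorem theorem4p1:
  fixes f :: "complex \<Rightarrow> complex" and \<sigma> \<epsilon> :: real
  assumes "f nicely_meromorphic_on UNIV"
    and "\<exists>z. f z \<noteq> 0"
    and "mero_order f = ereal \<sigma>"
    and "\<epsilon> > 0"
  shows "(\<lambda>r. proximity r (\<lambda>x. wilson_op f x / f x)) \<in> O[at_top](\<lambda>r. r powr (\<sigma> - 1 / 2 + \<epsilon>))"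
proof -
  interpret nonzero_meromorphic f by standard (use assms in auto)
  \<comment> \<open>Half of \<epsilon> is spent on the growth of the characteristic and half on
    \<alpha>: \<tau> - (1 - \<epsilon>) / 2 = \<sigma> - 1 / 2 + \<epsilon>. The maximum with 1 / 2
    keeps \<alpha> positive for large \<epsilon>.\<close>
  define \<tau> where "\<tau> = \<sigma> + \<epsilon> / 2"
  define \<alpha> where "\<alpha> = max (1 / 2) (1 - \<epsilon>)"
  have \<alpha>: "0 < \<alpha>" "\<alpha> < 1" and \<tau>: "\<tau> \<ge> 0" "\<tau> > \<sigma>"
    using assms(4) mero_order_nonneg[OF assms(3)] by (auto simp: \<alpha>_def \<tau>_def)
  define C where "C = 144 * pi + 16 * (2 * 2 powr \<alpha> * (24 powr \<alpha> * (2 * (3 * pi) powr (1 - \<alpha>) / (1 - \<alpha>)))) / \<alpha>"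
  have C0: "C \<ge> 0" using \<alpha> by (simp add: C_def)
  define c where "c = \<bar>ln (norm (zor_poly f 0 0))\<bar>"
  define M where "M = (2 * 7 powr \<tau> + c) / ln 2 + (2 * 7 powr \<tau> + c)"
  have M0: "M \<ge> 0" unfolding M_def c_def
    by (intro add_nonneg_nonneg divide_nonneg_nonneg mult_nonneg_nonneg) auto
  obtain r0 where r0: "\<And>r. r \<ge> r0 \<Longrightarrow> nevanlinna_char r f \<le> r powr \<tau>"
    using mero_order_char_le[OF assms(3) \<tau>(2)] by (auto simp: eventually_at_top_linorder)
  have "proximity r (\<lambda>x. wilson_op f x / f x) \<le> C * M * r powr (\<sigma> - 1 / 2 + \<epsilon>)" if r: "r \<ge> max 16 r0" for r
  proof -
    obtain R where R: "2 * r < R" "R < 3 * r" "\<And>z. norm z = R \<Longrightarrow> f z \<noteq> 0"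
      using exists_zero_free_circle[of "2 * r" "3 * r"] r by auto
    \<comment> \<open>The count in the disc of radius R < 3 r calls for a zero-free circle of radius
      at least 2 R, which S > 6 r provides. All radii stay below 7 r, whence 7 to the power \<tau>
      in \<open>M\<close>.\<close>
    obtain S where S: "6 * r < S" "S < 7 * r" "\<And>z. norm z = S \<Longrightarrow> f z \<noteq> 0"
      using exists_zero_free_circle[of "6 * r" "7 * r"] r by auto
    define N where "N = (\<Sum>a\<in>zeros_poles R. \<bar>real_of_int (zorder f a)\<bar>)"
    have T: "2 * nevanlinna_char t f - ln (norm (zor_poly f 0 0)) \<le> (2 * 7 powr \<tau> + c) * r powr \<tau>"
      if "r \<le> t" "t \<le> 7 * r" for t
    proof -
      have "nevanlinna_char t f \<le> t powr \<tau>" using that r by (intro r0) auto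
      also have "\<dots> \<le> (7 * r) powr \<tau>" using that r \<tau> by (intro powr_mono2) auto
      also have "\<dots> = 7 powr \<tau> * r powr \<tau>" using r by (simp add: powr_mult)
      finally have "nevanlinna_char t f \<le> 7 powr \<tau> * r powr \<tau>" .
      \<comment> \<open>As \<tau> \<ge> 0 and r \<ge> 1, the constant from Jensen's formula is
        absorbed into the power of r.\<close>
      moreover have "c * 1 \<le> c * r powr \<tau>"
        using r \<tau> by (intro mult_left_mono ge_one_powr_ge_zero) (auto simp: c_def)
      ultimately show ?thesis by (simp add: c_def distrib_right)
    qed
    have "log_mean R \<le> 2 * nevanlinna_char R f - ln (norm (zor_poly f 0 0))"
      using R r by (intro log_mean_le) auto
    also have "\<dots> \<le> (2 * 7 powr \<tau> + c) * r powr \<tau>" using R r by (intro T) auto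
    finally have J: "log_mean R \<le> (2 * 7 powr \<tau> + c) * r powr \<tau>" .
    have "ln 2 * N \<le> 2 * nevanlinna_char S f - ln (norm (zor_poly f 0 0))"
      unfolding N_def using R S r by (intro zeros_poles_count_le) auto
    also have "\<dots> \<le> (2 * 7 powr \<tau> + c) * r powr \<tau>" using S r by (intro T) auto
    finally have "N \<le> (2 * 7 powr \<tau> + c) * r powr \<tau> / ln 2"
      by (simp add: pos_le_divide_eq mult.commute)
    with J have NJ: "N + log_mean R \<le> M * r powr \<tau>" by (simp add: M_def distrib_right)
    have "proximity r (\<lambda>x. wilson_op f x / f x) \<le> C * (N + log_mean R) * r powr (- \<alpha> / 2)"
      unfolding C_def N_def using R r \<alpha> by (intro wilson_proximity_le) auto
    also have "\<dots> \<le> C * (M * r powr \<tau>) * r powr (- \<alpha> / 2)"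
      using NJ C0 by (intro mult_right_mono mult_left_mono) auto
    also have "\<dots> = C * M * r powr (\<tau> - \<alpha> / 2)"
      using powr_add[of r \<tau> "- \<alpha> / 2"] by (simp add: mult.assoc)
    also have "\<dots> \<le> C * M * r powr (\<sigma> - 1 / 2 + \<epsilon>)"
    proof (intro mult_left_mono powr_mono)
      have "1 - \<epsilon> \<le> \<alpha>" by (simp add: \<alpha>_def)
      thus "\<tau> - \<alpha> / 2 \<le> \<sigma> - 1 / 2 + \<epsilon>" unfolding \<tau>_def by argo
      show "0 \<le> C * M" using C0 M0 by (rule mult_nonneg_nonneg)
    qed (use r in auto)
    finally show ?thesis .
  qed
  hence "eventually (\<lambda>r. norm (proximity r (\<lambda>x. wilson_op f x / f x)) \<le> C * M * norm (r powr (\<sigma> - 1 / 2 + \<epsilon>))) at_top"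
    using eventually_ge_at_top[of "max 16 r0"] proximity_nonneg
    by (auto elim!: eventually_mono)
  thus ?thesis by (rule bigoI)
qed

end
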